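(* Let $\mathbf{G}$ be a Carnot group and let $u:\mathbf{G}\to\mathbb{R}$ be upper semicontinuous, locally bounded from below, and v-convex on $\mathbf{G}$. Then $u$ is h-convex on $\mathbf{G}$.
   Context: A Carnot group of step $r\ge 1$ is a simply connected Lie group $\mathbf{G}$ whose (finite-dimensional real) Lie algebra admits a vector space decomposition $\mathfrak{g}=V_1\oplus\cdots\oplus V_r$ with $[V_1,V_j]=V_{j+1}$ for $j=1,\dots,r-1$ and $[V_j,V_r]=0$ for $j=1,\dots,r$. The exponential map $\exp:\mathfrak{g}\to\mathbf{G}$ is a global diffeomorphism. Fix an inner product on $\mathfrak{g}$ for which the $V_j$ are mutually orthogonal, let $m=\dim V_1$, and let $X_1,\dots,X_m$ be a fixed orthonormal basis of $V_1$, regarded as left-invariant vector fields on $\mathbf{G}$. For a sufficiently regular function $\phi$, the horizontal hessian is the symmetric $m\times m$ matrix $\nabla_h^2\phi=\left(\tfrac{X_iX_j+X_jX_i}{2}\phi\right)_{1\le i,j\le m}$. v-convexity: for a domain $\Omega\subset\mathbf{G}$, an upper semicontinuous function $u:\Omega\to\mathbb{R}$ is v-convex (convex in the viscosity sense) on $\Omega$ if for every $\xi\in\mathbb{R}^m$, every $p\in\Omega$ and every $\phi\in C^2(\Omega)$ touching $u$ from above at $p$ (i.e. $\phi(p)=u(p)$ and $\phi\ge u$ in a neighborhood of $p$), one has $\xi^T\nabla_h^2\phi(p)\,\xi=\sum_{i,j=1}^m\xi_i\xi_jX_iX_j\phi(p)\ge 0$. h-convexity: for $p\in\mathbf{G}$,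 the horizontal plane at $p$ is $H_p(\mathbf{G})=\{p\cdot\exp(\xi):\xi\in V_1\}$, the set of points reached from $p$ by flowing along horizontal left-invariant vector fields. For $q=p\cdot\exp(\xi)\in H_p(\mathbf{G})$ with $\xi\in V_1$, the horizontal segment joining $p$ and $q$ is $[p,q]=\{p\cdot\exp(t\xi):t\in[0,1]\}$. A function $u:\Omega\to\mathbb{R}$ on a domain $\Omega\subset\mathbf{G}$ is h-convex (horizontally convex) on $\Omega$ if for all $p\in\Omega$ and $q=p\cdot\exp(\xi)\in H_p(\mathbf{G})\cap\Omega$ with $[p,q]\subset\Omega$, the restriction $u|_{[p,q]}$ is convex, i.e. $t\mapsto u(p\cdot\exp(t\xi))$ is convex on $[0,1]$. Locally bounded from below means that every point has a neighborhood on which $u$ is bounded from below. *)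

theory Defs
  imports "HOL-Analysis.Analysis"
begin

section \<open>Functions of class \<open>C\<^sup>k\<close> between normed spaces\<close>

text \<open>The set \<open>S\<close> is meant to be open and the domain finite-dimensional; then continuity of
  all directional derivatives amounts to continuity of the derivative.\<close>

fun Ck_on :: "nat \<Rightarrow> 'a::real_normed_vector set \<Rightarrow> ('a \<Rightarrow> 'b::real_normed_vector) \<Rightarrow> bool" where
  "Ck_on 0 S f \<longleftrightarrow> continuous_on S f"
| "Ck_on (Suc k) S f \<longleftrightarrow>
     (\<forall>x\<in>S. f differentiable (at x)) \<and>
     (\<forall>v. Ck_on k S (\<lambda>x. frechet_derivative f (at x) v))"

definition smooth_on :: "'a::real_normed_vector set \<Rightarrow> ('a \<Rightarrow> 'b::real_normed_vector) \<Rightarrow> bool" where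
  "smooth_on S f \<longleftrightarrow> (\<forall>k. Ck_on k S f)"


section \<open>Smooth manifolds\<close>

text \<open>A chart \<open>(U, c)\<close> consists of its domain \<open>U\<close> and a coordinate map \<open>c\<close>, whose values
  outside \<open>U\<close> are irrelevant.\<close>

type_synonym ('g, 'e) chart = "'g set \<times> ('g \<Rightarrow> 'e)"

definition smooth_atlas :: "('g::topological_space, 'e::euclidean_space) chart set \<Rightarrow> bool" where
  "smooth_atlas A \<longleftrightarrow>
     (\<forall>(U, c)\<in>A. open U \<and> open (c ` U) \<and> homeomorphism U (c ` U) c (inv_into U c)) \<and>
     (\<Union>(U, c)\<in>A. U) = UNIV \<and>
     (\<forall>(U, c)\<in>A. \<forall>(W, d)\<in>A. smooth_on (c ` (U \<inter> W)) (d \<circ> inv_into U c))"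

definition Ck_fun ::
  "('g::topological_space, 'e::euclidean_space) chart set \<Rightarrow> nat \<Rightarrow> 'g set \<Rightarrow> ('g \<Rightarrow> real) \<Rightarrow> bool" where
  "Ck_fun A k \<Omega> f \<longleftrightarrow> (\<forall>(U, c)\<in>A. Ck_on k (c ` (U \<inter> \<Omega>)) (f \<circ> inv_into U c))"

definition smooth_fun ::
  "('g::topological_space, 'e::euclidean_space) chart set \<Rightarrow> 'g set \<Rightarrow> ('g \<Rightarrow> real) \<Rightarrow> bool" where
  "smooth_fun A \<Omega> f \<longleftrightarrow> (\<forall>k. Ck_fun A k \<Omega> f)"

definition C1_near ::
  "('g::topological_space, 'e::euclidean_space) chart set \<Rightarrow> 'g \<Rightarrow> ('g \<Rightarrow> real) \<Rightarrow> bool" where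
  "C1_near A p f \<longleftrightarrow> (\<exists>W. open W \<and> p \<in> W \<and> Ck_fun A 1 W f)"

definition smooth_curve ::
  "('g::topological_space, 'e::euclidean_space) chart set \<Rightarrow> real set \<Rightarrow> (real \<Rightarrow> 'g) \<Rightarrow> bool" where
  "smooth_curve A I \<sigma> \<longleftrightarrow>
     continuous_on I \<sigma> \<and> (\<forall>(U, c)\<in>A. smooth_on {t\<in>I. \<sigma> t \<in> U} (c \<circ> \<sigma>))"

text \<open>A tangent vector at \<open>p\<close> is the velocity at time 0 of a smooth curve through \<open>p\<close>, identified
  with the directional derivative it induces on functions that are \<open>C\<^sup>1\<close> near \<open>p\<close>.  The value 0
  on all other functions makes the functional depend on the velocity only.\<close>

definition tangent_space ::
  "('g::topological_space, 'e::euclidean_space) chart set \<Rightarrow> 'g \<Rightarrow> (('g \<Rightarrow> real) \<Rightarrow> real) set" where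
  "tangent_space A p =
     {(\<lambda>f. if C1_near A p f then deriv (\<lambda>t. f (\<sigma> t)) 0 else 0) | \<sigma>.
        \<sigma> 0 = p \<and> (\<exists>\<epsilon>>0. smooth_curve A {-\<epsilon><..<\<epsilon>} \<sigma>)}"


section \<open>Lie groups\<close>

text \<open>Groups are written additively, following the library's class
  \<^class>\<open>topological_group_add\<close>, which does not assume commutativity: the product of \<open>p\<close> and \<open>q\<close>
  is \<open>p + q\<close>, and the neutral element is \<open>0\<close>.\<close>

locale lie_group =
  fixes A :: "('g::{topological_group_add, t2_space, second_countable_topology},
               'e::euclidean_space) chart set"
  assumes atlas: "smooth_atlas A"
    and mult_smooth:
      "\<And>U c V d W b. (U, c) \<in> A \<Longrightarrow> (V, d) \<in> A \<Longrightarrow> (W, b) \<in> A \<Longrightarrow>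
         smooth_on {(x, y) \<in> (c ` U) \<times> (d ` V). inv_into U c x + inv_into V d y \<in> W}
                   (\<lambda>(x, y). b (inv_into U c x + inv_into V d y))"
    and inverse_smooth:
      "\<And>U c W b. (U, c) \<in> A \<Longrightarrow> (W, b) \<in> A \<Longrightarrow>
         smooth_on {x \<in> c ` U. - inv_into U c x \<in> W} (\<lambda>x. b (- inv_into U c x))"

text \<open>The Lie algebra, together with its fixed inner product, is a type \<open>'v\<close> of class
  \<^class>\<open>euclidean_space\<close> that is identified with the tangent space at the neutral element by a
  linear bijection \<open>D\<close>.\<close>

definition lie_algebra_iso ::
  "('g::topological_group_add, 'e::euclidean_space) chart set \<Rightarrow>
   ('v::euclidean_space \<Rightarrow> ('g \<Rightarrow> real) \<Rightarrow> real) \<Rightarrow> bool" where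
  "lie_algebra_iso A D \<longleftrightarrow>
     bij_betw D UNIV (tangent_space A 0) \<and>
     (\<forall>a b v w f. D (a *\<^sub>R v + b *\<^sub>R w) f = a * D v f + b * D w f)"

text \<open>The left-invariant vector field with value \<open>v\<close> at the neutral element, acting on functions.\<close>

definition left_inv_field ::
  "('v \<Rightarrow> ('g::topological_group_add \<Rightarrow> real) \<Rightarrow> real) \<Rightarrow> 'v \<Rightarrow> ('g \<Rightarrow> real) \<Rightarrow> 'g \<Rightarrow> real" where
  "left_inv_field D v f p = D v (\<lambda>x. f (p + x))"

definition lie_bracket ::
  "('g::topological_group_add, 'e::euclidean_space) chart set \<Rightarrow>
   ('v::euclidean_space \<Rightarrow> ('g \<Rightarrow> real) \<Rightarrow> real) \<Rightarrow> 'v \<Rightarrow> 'v \<Rightarrow> 'v" where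
  "lie_bracket A D v w =
     (THE z. \<forall>f p. smooth_fun A UNIV f \<longrightarrow>
        left_inv_field D z f p =
          left_inv_field D v (left_inv_field D w f) p
          - left_inv_field D w (left_inv_field D v f) p)"

definition one_param_subgroup ::
  "('g::topological_group_add, 'e::euclidean_space) chart set \<Rightarrow>
   ('v::euclidean_space \<Rightarrow> ('g \<Rightarrow> real) \<Rightarrow> real) \<Rightarrow> 'v \<Rightarrow> (real \<Rightarrow> 'g) \<Rightarrow> bool" where
  "one_param_subgroup A D v \<gamma> \<longleftrightarrow>
     continuous_on UNIV \<gamma> \<and>
     (\<forall>s t. \<gamma> (s + t) = \<gamma> s + \<gamma> t) \<and>
     (\<forall>f. C1_near A 0 f \<longrightarrow> ((\<lambda>t. f (\<gamma> t)) has_real_derivative D v f) (at 0))"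

definition lie_exp ::
  "('g::topological_group_add, 'e::euclidean_space) chart set \<Rightarrow>
   ('v::euclidean_space \<Rightarrow> ('g \<Rightarrow> real) \<Rightarrow> real) \<Rightarrow> 'v \<Rightarrow> 'g" where
  "lie_exp A D v = (THE \<gamma>. one_param_subgroup A D v \<gamma>) 1"


section \<open>Carnot groups\<close>

text \<open>\<open>V 1, ..., V r\<close> are the layers of the stratification and \<open>X 1, ..., X m\<close> is the fixed
  orthonormal basis of the first one.\<close>

locale carnot_group = lie_group A
  for A :: "('g::{topological_group_add, t2_space, second_countable_topology},
             'e::euclidean_space) chart set" +
  fixes D :: "'v::euclidean_space \<Rightarrow> ('g \<Rightarrow> real) \<Rightarrow> real"
    and r :: nat
    and V :: "nat \<Rightarrow> 'v set"
    and m :: nat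
    and X :: "nat \<Rightarrow> 'v"
  assumes simply_connected: "simply_connected (UNIV :: 'g set)"
    and lie_algebra: "lie_algebra_iso A D"
    and step: "r \<ge> 1"
    and layers: "\<And>j. j \<in> {1..r} \<Longrightarrow> subspace (V j)"
    and direct_sum: "\<And>v. \<exists>!w. w \<in> (\<Pi>\<^sub>E j\<in>{1..r}. V j) \<and> v = (\<Sum>j=1..r. w j)"
    and generating: "\<And>j. j \<in> {1..<r} \<Longrightarrow>
           span {lie_bracket A D v w | v w. v \<in> V 1 \<and> w \<in> V j} = V (j + 1)"
    and top_layer_central: "\<And>j v w. j \<in> {1..r} \<Longrightarrow> v \<in> V j \<Longrightarrow> w \<in> V r \<Longrightarrow> lie_bracket A D v w = 0"
    and orthogonal_layers: "\<And>i j v w. i \<in> {1..r} \<Longrightarrow> j \<in> {1..r} \<Longrightarrow> i \<noteq> j \<Longrightarrow>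
           v \<in> V i \<Longrightarrow> w \<in> V j \<Longrightarrow> inner v w = 0"
    and m_eq: "m = dim (V 1)"
    and basis_span: "span (X ` {1..m}) = V 1"
    and basis_orthonormal: "\<And>i j. i \<in> {1..m} \<Longrightarrow> j \<in> {1..m} \<Longrightarrow>
           inner (X i) (X j) = (if i = j then 1 else 0)"


section \<open>Semicontinuity and local boundedness\<close>

definition usc_on :: "'g::topological_space set \<Rightarrow> ('g \<Rightarrow> real) \<Rightarrow> bool" where
  "usc_on \<Omega> u \<longleftrightarrow> (\<forall>p\<in>\<Omega>. \<forall>K>u p. \<forall>\<^sub>F x in at p within \<Omega>. u x < K)"

definition locally_bounded_below_on :: "'g::topological_space set \<Rightarrow> ('g \<Rightarrow> real) \<Rightarrow> bool" where
  "locally_bounded_below_on \<Omega> u \<longleftrightarrow>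
     (\<forall>p\<in>\<Omega>. \<exists>W. open W \<and> p \<in> W \<and> (\<exists>K. \<forall>x\<in>W \<inter> \<Omega>. K \<le> u x))"


section \<open>Convexity in the viscosity sense\<close>

definition horizontal_hessian ::
  "('v \<Rightarrow> ('g::topological_group_add \<Rightarrow> real) \<Rightarrow> real) \<Rightarrow> (nat \<Rightarrow> 'v) \<Rightarrow>
   ('g \<Rightarrow> real) \<Rightarrow> 'g \<Rightarrow> nat \<Rightarrow> nat \<Rightarrow> real" where
  "horizontal_hessian D X \<phi> p i j =
     (left_inv_field D (X i) (left_inv_field D (X j) \<phi>) p
      + left_inv_field D (X j) (left_inv_field D (X i) \<phi>) p) / 2"

definition touches_above_at :: "('g::topological_space \<Rightarrow> real) \<Rightarrow> ('g \<Rightarrow> real) \<Rightarrow> 'g \<Rightarrow> bool" where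
  "touches_above_at \<phi> u p \<longleftrightarrow> \<phi> p = u p \<and> (\<forall>\<^sub>F x in nhds p. u x \<le> \<phi> x)"

text \<open>In the following two definitions \<open>\<Omega>\<close> is meant to be a domain.\<close>

definition v_convex_on ::
  "('g::topological_group_add, 'e::euclidean_space) chart set \<Rightarrow>
   ('v::euclidean_space \<Rightarrow> ('g \<Rightarrow> real) \<Rightarrow> real) \<Rightarrow> nat \<Rightarrow> (nat \<Rightarrow> 'v) \<Rightarrow>
   'g set \<Rightarrow> ('g \<Rightarrow> real) \<Rightarrow> bool" where
  "v_convex_on A D m X \<Omega> u \<longleftrightarrow>
     usc_on \<Omega> u \<and>
     (\<forall>(\<xi> :: nat \<Rightarrow> real). \<forall>p\<in>\<Omega>. \<forall>\<phi>. Ck_fun A 2 \<Omega> \<phi> \<longrightarrow> touches_above_at \<phi> u p \<longrightarrow>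
        (\<Sum>i=1..m. \<Sum>j=1..m. \<xi> i * horizontal_hessian D X \<phi> p i j * \<xi> j) \<ge> 0)"


section \<open>Horizontal convexity\<close>

text \<open>Here \<open>H\<close> is the first layer of the Lie algebra.\<close>

definition horizontal_plane ::
  "('g::topological_group_add, 'e::euclidean_space) chart set \<Rightarrow>
   ('v::euclidean_space \<Rightarrow> ('g \<Rightarrow> real) \<Rightarrow> real) \<Rightarrow> 'v set \<Rightarrow> 'g \<Rightarrow> 'g set" where
  "horizontal_plane A D H p = {p + lie_exp A D \<xi> | \<xi>. \<xi> \<in> H}"

definition horizontal_segment ::
  "('g::topological_group_add, 'e::euclidean_space) chart set \<Rightarrow>
   ('v::euclidean_space \<Rightarrow> ('g \<Rightarrow> real) \<Rightarrow> real) \<Rightarrow> 'g \<Rightarrow> 'v \<Rightarrow> 'g set" where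
  "horizontal_segment A D p \<xi> = {p + lie_exp A D (t *\<^sub>R \<xi>) | t. t \<in> {0..1}}"

definition h_convex_on ::
  "('g::topological_group_add, 'e::euclidean_space) chart set \<Rightarrow>
   ('v::euclidean_space \<Rightarrow> ('g \<Rightarrow> real) \<Rightarrow> real) \<Rightarrow> 'v set \<Rightarrow>
   'g set \<Rightarrow> ('g \<Rightarrow> real) \<Rightarrow> bool" where
  "h_convex_on A D H \<Omega> u \<longleftrightarrow>
     (\<forall>p\<in>\<Omega>. \<forall>q\<in>horizontal_plane A D H p \<inter> \<Omega>. \<forall>\<xi>\<in>H.
        q = p + lie_exp A D \<xi> \<longrightarrow> horizontal_segment A D p \<xi> \<subseteq> \<Omega> \<longrightarrow>
        convex_on {0..1} (\<lambda>t. u (p + lie_exp A D (t *\<^sub>R \<xi>))))"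

end

theory Submission
  imports Defs
begin

text \<open>
  Write \<open>L\<close> for the left-invariant field of a horizontal vector \<open>\<xi>\<close> and \<open>\<gamma>\<close> for its one-parameter
  subgroup.  Summing the entries of the horizontal hessian against the coefficients of \<open>\<xi>\<close> gives
  \<open>L (L \<phi>)\<close> (\<open>horizontal_hessian_quadratic_form\<close>), and the flow lines of \<open>L\<close> are the curves
  \<open>t \<mapsto> p + \<gamma> t\<close>.  So v-convexity says that \<open>u\<close> is a viscosity subsolution of \<open>L (L u) \<ge> 0\<close>, and the
  claim is that an upper semicontinuous subsolution is convex along every flow line
  (\<open>usc_subsolution_convex_along_subgroup\<close>).

  Suppose that convexity of \<open>t \<mapsto> u (p + \<gamma> t)\<close> fails between \<open>a\<close> and \<open>b\<close>.  Then there is a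
  quadratic \<open>q\<close> with \<open>q'' < 0\<close> that lies strictly above this function at \<open>a\<close> and \<open>b\<close>, and strictly
  below it at some time in between.  To isolate the flow line through \<open>p\<close>, let a second variable
  \<open>y\<close> range over a small closed coordinate ball around \<open>p\<close> and maximise
  \<open>u (y + \<gamma> t) - q t - C * |y - p|\<^sup>2\<close>.  For a small ball the two end faces \<open>t = a, b\<close> carry
  negative values, by upper semicontinuity, and for large \<open>C\<close> so does the lateral boundary.
  Hence a positive maximum is attained at an interior point \<open>(t1, y1)\<close>.

  The pair \<open>(t, y)\<close> is one coordinate richer than the point \<open>x = y + \<gamma> t\<close> that it describes.
  Whatever function \<open>\<tau>\<close> with \<open>\<tau> x1 = t1\<close> is chosen near \<open>x1 = y1 + \<gamma> t1\<close>, substituting \<open>t = \<tau> x\<close>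
  and \<open>y = x + \<gamma> (- \<tau> x)\<close> into \<open>q t + C * |y - p|\<^sup>2\<close> produces, up to a constant, a function that
  touches \<open>u\<close> from above at \<open>x1\<close>.  If \<open>\<tau>\<close> is a quadratic polynomial in a chart with
  \<open>\<tau> (x1 + \<gamma> s) = t1 + s + o(s\<^sup>2)\<close>, then \<open>y\<close> is constant to second order along the flow line through
  \<open>x1\<close>, and \<open>L (L \<phi>) x1 = q'' t1 < 0\<close>: a contradiction (\<open>test_function_with_time\<close>).  This freedom in
  the choice of \<open>\<tau>\<close> replaces a flow box, that is, any use of the inverse function theorem.

  Since the exponential map is defined through one-parameter subgroups, their existence,
  uniqueness and smoothness have to be established as well.  In a chart at the neutral element
  they solve an autonomous differential equation (\<open>ode_exists\<close>, \<open>ode_unique\<close>).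
  Left invariance of the field makes a solution additive for small times
  (\<open>local_one_parameter_group\<close>), and an additive map on a neighbourhood of \<open>0\<close> extends to the whole
  line (\<open>local_hom_extends\<close>).
\<close>

section \<open>Calculus of \<open>C\<^sup>k\<close> functions\<close>

lemma Ck_on_cong:
  assumes "open S" "\<And>x. x \<in> S \<Longrightarrow> f x = g x" "Ck_on k S f"
  shows "Ck_on k S g"
  using assms(2,3)
proof (induction k arbitrary: f g)
  case 0
  then show ?case by (simp cong: continuous_on_cong)
next
  case (Suc k)
  have "g differentiable at x" if "x \<in> S" for x
    using Suc.prems that has_derivative_transform_within_open[OF _ assms(1) that, of f _ UNIV g]
    unfolding differentiable_def by (metis Ck_on.simps(2) differentiable_def)
  moreover have "frechet_derivative f (at x) = frechet_derivative g (at x)" if "x \<in> S" for x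
    using Suc.prems assms(1) that
    by (intro frechet_derivative_transform_within_open[where X=S]) auto
  then have "Ck_on k S (\<lambda>x. frechet_derivative g (at x) v)" for v
    using Suc.prems Suc.IH[of "\<lambda>x. frechet_derivative f (at x) v" "\<lambda>x. frechet_derivative g (at x) v"]
    by simp
  ultimately show ?case by simp
qed

lemma Ck_on_local:
  assumes "\<And>x. x \<in> S \<Longrightarrow> \<exists>T. open T \<and> x \<in> T \<and> Ck_on k T f"
  shows "Ck_on k S f"
  using assms
proof (induction k arbitrary: f)
  case 0
  then show ?case
    by (auto intro!: continuous_at_imp_continuous_on simp: continuous_on_eq_continuous_at)
      (metis continuous_on_eq_continuous_at)
next
  case (Suc k)
  have "f differentiable at x" if "x \<in> S" for x
    using Suc.prems[OF that] by auto
  moreover have "Ck_on k S (\<lambda>x. frechet_derivative f (at x) v)" for v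
    by (rule Suc.IH) (use Suc.prems in \<open>fastforce\<close>)
  ultimately show ?case by simp
qed

lemma Ck_on_subset: "Ck_on k S f \<Longrightarrow> T \<subseteq> S \<Longrightarrow> Ck_on k T f"
  by (induction k arbitrary: f) (auto intro: continuous_on_subset)

lemma Ck_on_Suc_imp: "Ck_on (Suc k) S f \<Longrightarrow> Ck_on k S f"
proof (induction k arbitrary: f)
  case 0
  then show ?case
    by (auto intro!: continuous_at_imp_continuous_on differentiable_imp_continuous_within)
next
  case (Suc k)
  then show ?case using Suc.IH by (metis Ck_on.simps(2))
qed

lemma Ck_on_le: "Ck_on n S f \<Longrightarrow> k \<le> n \<Longrightarrow> Ck_on k S f"
  by (induction n) (auto simp: le_Suc_eq dest: Ck_on_Suc_imp simp del: Ck_on.simps(2))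

lemma Ck_on_continuous: "Ck_on k S f \<Longrightarrow> continuous_on S f"
  using Ck_on_le[of k S f 0] by simp

lemma Ck_on_differentiable: "Ck_on k S f \<Longrightarrow> 0 < k \<Longrightarrow> x \<in> S \<Longrightarrow> f differentiable at x"
  by (cases k) auto

lemma Ck_on_has_derivative:
  "Ck_on (Suc k) S f \<Longrightarrow> x \<in> S \<Longrightarrow> (f has_derivative frechet_derivative f (at x)) (at x)"
  by (simp add: frechet_derivative_works)

text \<open>The form in which the induction step of all closure properties below is carried out: any
  explicit formula for the derivative may take the place of \<^const>\<open>frechet_derivative\<close>.\<close>

lemma Ck_on_SucI:
  assumes "open S" "\<And>x. x \<in> S \<Longrightarrow> (f has_derivative f' x) (at x)"
    and "\<And>v. Ck_on k S (\<lambda>x. f' x v)"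
  shows "Ck_on (Suc k) S f"
proof -
  have "frechet_derivative f (at x) = f' x" if "x \<in> S" for x
    using frechet_derivative_at[OF assms(2)[OF that]] by simp
  then have "Ck_on k S (\<lambda>x. frechet_derivative f (at x) v)" for v
    by (intro Ck_on_cong[OF assms(1) _ assms(3)]) simp
  with assms(2) show ?thesis by (auto simp: differentiable_def)
qed

lemma Ck_on_const: "Ck_on k S (\<lambda>x. a)"
  by (induction k arbitrary: a) auto

lemma Ck_on_bounded_linear_fun: "bounded_linear h \<Longrightarrow> Ck_on k S h"
proof (cases k)
  case 0
  assume "bounded_linear h" with 0 show ?thesis by (simp add: linear_continuous_on)
next
  case (Suc n)
  assume h: "bounded_linear h"
  then have "frechet_derivative h (at x) = h" for x
    by (metis bounded_linear_imp_has_derivative frechet_derivative_at)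
  with h Suc show ?thesis
    by (auto simp: Ck_on_const bounded_linear_imp_differentiable)
qed

lemma Ck_on_bounded_linear:
  assumes "bounded_linear h" "open S" "Ck_on k S f"
  shows "Ck_on k S (\<lambda>x. h (f x))"
  using assms(3)
proof (induction k arbitrary: f)
  case 0
  then show ?case using assms(1) by (simp add: bounded_linear.continuous_on)
next
  case (Suc k)
  have D: "((\<lambda>x. h (f x)) has_derivative (\<lambda>v. h (frechet_derivative f (at x) v))) (at x)" if "x \<in> S" for x
    by (rule bounded_linear.has_derivative[OF assms(1) Ck_on_has_derivative[OF Suc.prems that]])
  have "Ck_on k S (\<lambda>x. h (frechet_derivative f (at x) v))" for v
    by (rule Suc.IH) (use Suc.prems in auto)
  then show ?case by (rule Ck_on_SucI[OF assms(2) D, rotated])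
qed

lemma Ck_on_add:
  assumes "open S" "Ck_on k S f" "Ck_on k S g"
  shows "Ck_on k S (\<lambda>x. f x + g x)"
  using assms(2,3)
proof (induction k arbitrary: f g)
  case 0
  then show ?case by (simp add: continuous_on_add)
next
  case (Suc k)
  have D: "((\<lambda>x. f x + g x) has_derivative
      (\<lambda>v. frechet_derivative f (at x) v + frechet_derivative g (at x) v)) (at x)" if "x \<in> S" for x
    by (intro has_derivative_add Ck_on_has_derivative[OF Suc.prems(1) that]
        Ck_on_has_derivative[OF Suc.prems(2) that])
  have "Ck_on k S (\<lambda>x. frechet_derivative f (at x) v + frechet_derivative g (at x) v)" for v
    by (rule Suc.IH) (use Suc.prems in auto)
  then show ?case by (rule Ck_on_SucI[OF assms(1) D, rotated])
qed

lemma Ck_on_sum: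
  assumes "open S" "\<And>i. i \<in> I \<Longrightarrow> Ck_on k S (f i)"
  shows "Ck_on k S (\<lambda>x. \<Sum>i\<in>I. f i x)"
  using assms(2)
  by (induction I rule: infinite_finite_induct) (auto simp: Ck_on_const intro: Ck_on_add[OF assms(1)])

lemma Ck_on_bilinear:
  assumes "bounded_bilinear h" "open S" "Ck_on k S f" "Ck_on k S g"
  shows "Ck_on k S (\<lambda>x. h (f x) (g x))"
  using assms(3,4)
proof (induction k arbitrary: f g)
  case 0
  then show ?case using assms(1) by (simp add: bounded_bilinear.continuous_on)
next
  case (Suc k)
  have D: "((\<lambda>x. h (f x) (g x)) has_derivative
      (\<lambda>v. h (f x) (frechet_derivative g (at x) v) + h (frechet_derivative f (at x) v) (g x))) (at x)"
    if "x \<in> S" for x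
    by (intro bounded_bilinear.FDERIV[OF assms(1)] Ck_on_has_derivative[OF Suc.prems(1) that]
        Ck_on_has_derivative[OF Suc.prems(2) that])
  have "Ck_on k S (\<lambda>x. h (f x) (frechet_derivative g (at x) v) + h (frechet_derivative f (at x) v) (g x))" for v
    by (intro Ck_on_add[OF assms(2)] Suc.IH) (use Suc.prems Ck_on_Suc_imp in \<open>auto simp del: Ck_on.simps(2)\<close>, auto)
  then show ?case by (rule Ck_on_SucI[OF assms(2) D, rotated])
qed

lemmas Ck_on_mult = Ck_on_bilinear[OF bounded_bilinear_mult]
lemmas Ck_on_inner = Ck_on_bilinear[OF bounded_bilinear_inner]
lemmas Ck_on_scaleR = Ck_on_bilinear[OF bounded_bilinear_scaleR]

lemma Ck_on_minus: "open S \<Longrightarrow> Ck_on k S f \<Longrightarrow> Ck_on k S (\<lambda>x. - f x)"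
  by (rule Ck_on_bounded_linear[OF bounded_linear_minus[OF bounded_linear_ident]])

lemma Ck_on_diff: "open S \<Longrightarrow> Ck_on k S f \<Longrightarrow> Ck_on k S g \<Longrightarrow> Ck_on k S (\<lambda>x. f x - g x)"
  using Ck_on_add[OF _ _ Ck_on_minus, of S k f g] by simp

lemma Ck_on_power:
  fixes f :: "'a::real_normed_vector \<Rightarrow> real"
  shows "open S \<Longrightarrow> Ck_on k S f \<Longrightarrow> Ck_on k S (\<lambda>x. f x ^ n)"
  by (induction n) (auto simp: Ck_on_const intro: Ck_on_mult)

lemma Ck_on_Pair:
  assumes S: "open S" and f: "Ck_on k S f" and g: "Ck_on k S g"
  shows "Ck_on k S (\<lambda>x. (f x, g x))"
proof -
  have 1: "bounded_linear (\<lambda>y::'b. (y, 0::'c))"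
    and 2: "bounded_linear (\<lambda>y::'c. (0::'b, y))"
    by (auto intro!: bounded_linear_Pair bounded_linear_ident bounded_linear_zero)
  have "Ck_on k S (\<lambda>x. (f x, 0::'c) + (0::'b, g x))"
    by (intro Ck_on_add Ck_on_bounded_linear[OF 1] Ck_on_bounded_linear[OF 2] assms)
  then show ?thesis by simp
qed

text \<open>The chain rule expresses the derivative of a composition through the derivatives of \<open>g\<close> in
  varying directions.  Expanding the direction in a basis of the intermediate space leaves
  derivatives in fixed directions, which are the ones that \<^const>\<open>Ck_on\<close> speaks about.\<close>

lemma Ck_on_compose:
  fixes f :: "'a::real_normed_vector \<Rightarrow> 'b::euclidean_space"
  assumes S: "open S" and T: "open T" and sub: "\<And>x. x \<in> S \<Longrightarrow> f x \<in> T"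
    and g: "Ck_on k T g" and f: "Ck_on k S f"
  shows "Ck_on k S (\<lambda>x. g (f x))"
  using g f
proof (induction k arbitrary: g)
  case 0
  then show ?case using sub by (auto intro: continuous_on_compose2)
next
  case (Suc k)
  let ?f' = "\<lambda>x. frechet_derivative f (at x)" and ?g' = "\<lambda>y. frechet_derivative g (at y)"
  have lin: "linear (?g' (f x))" if "x \<in> S" for x
    using Suc.prems(1) sub[OF that] by (auto intro: linear_frechet_derivative)
  have D: "((\<lambda>x. g (f x)) has_derivative (\<lambda>v. ?g' (f x) (?f' x v))) (at x)" if "x \<in> S" for x
    by (rule has_derivative_compose[OF Ck_on_has_derivative[OF Suc.prems(2) that]
        Ck_on_has_derivative[OF Suc.prems(1) sub[OF that]]])
  have eq: "?g' (f x) (?f' x v) = (\<Sum>b\<in>Basis. (?f' x v \<bullet> b) *\<^sub>R ?g' (f x) b)" if "x \<in> S" for x v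
    using linear_sum[OF lin[OF that], of "\<lambda>b. (?f' x v \<bullet> b) *\<^sub>R b" Basis]
    by (simp add: euclidean_representation linear_cmul[OF lin[OF that]])
  have "Ck_on k S (\<lambda>x. \<Sum>b\<in>Basis. (?f' x v \<bullet> b) *\<^sub>R ?g' (f x) b)" for v
    by (intro Ck_on_sum Ck_on_scaleR Suc.IH Ck_on_inner Ck_on_const S)
      (use Suc.prems Ck_on_Suc_imp in \<open>auto simp del: Ck_on.simps(2)\<close>, auto)
  then show ?case by (intro Ck_on_SucI[OF S D]) (auto intro: Ck_on_cong[OF S] simp: eq)
qed

lemma Ck_on_one_real:
  fixes f :: "real \<Rightarrow> 'b::real_normed_vector"
  assumes "open S" "\<And>x. x \<in> S \<Longrightarrow> (f has_vector_derivative f' x) (at x)" "Ck_on k S f'"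
  shows "Ck_on (Suc k) S f"
proof -
  have D: "frechet_derivative f (at x) = (\<lambda>v. v *\<^sub>R f' x)" if "x \<in> S" for x
    using frechet_derivative_at[of f _ x] assms(2)[OF that] by (metis has_vector_derivative_def)
  have "Ck_on k S (\<lambda>x. frechet_derivative f (at x) v)" for v
    by (rule Ck_on_cong[where f="\<lambda>x. v *\<^sub>R f' x"])
      (use D assms in \<open>auto intro: Ck_on_bounded_linear[OF bounded_linear_scaleR_right]\<close>)
  then show ?thesis using assms(2) by (auto intro: differentiableI_vector)
qed

lemma Ck_on_real_deriv:
  fixes f :: "real \<Rightarrow> real"
  assumes "open S" "Ck_on (Suc k) S f"
  shows "Ck_on k S (deriv f)" "x \<in> S \<Longrightarrow> (f has_real_derivative deriv f x) (at x)"
proof -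
  have D: "(f has_real_derivative deriv f x) (at x)" if "x \<in> S" for x
    using assms that by (auto simp: real_differentiable_def DERIV_deriv_iff_real_differentiable)
  then show "x \<in> S \<Longrightarrow> (f has_real_derivative deriv f x) (at x)" .
  have "frechet_derivative f (at x) 1 = deriv f x" if "x \<in> S" for x
    using frechet_derivative_at[of f _ x] D[OF that] by (metis has_field_derivative_def mult.right_neutral)
  moreover have "Ck_on k S (\<lambda>x. frechet_derivative f (at x) 1)" using assms by auto
  ultimately show "Ck_on k S (deriv f)" by (metis (no_types, lifting) Ck_on_cong assms(1))
qed

section \<open>A \<open>C\<^sup>2\<close> cutoff function\<close>

text \<open>A transition from 0 to 1 that is constant outside \<open>[0, 1]\<close>.  It is only \<open>C\<^sup>2\<close>, which is
  the regularity of test functions, because it is built from cubes of positive parts.\<close>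

definition C2_step :: "real \<Rightarrow> real" where
  "C2_step s = 1 - (max 0 (1 - (max 0 s) ^ 3)) ^ 3"

lemma C2_step_le_0: "s \<le> 0 \<Longrightarrow> C2_step s = 0"
  by (simp add: C2_step_def)

lemma C2_step_ge_1: "s \<ge> 1 \<Longrightarrow> C2_step s = 1"
proof -
  assume "s \<ge> 1"
  then have "(max 0 s) ^ 3 \<ge> 1" by (simp add: one_le_power)
  then show ?thesis by (simp add: C2_step_def max_absorb1)
qed

lemma has_real_derivative_pos_part_power:
  "((\<lambda>s. (max 0 s) ^ Suc (Suc n)) has_real_derivative (real (Suc (Suc n)) * (max 0 s) ^ Suc n)) (at (s::real))"
proof (cases "s = 0")
  case True
  have "((\<lambda>h. (max 0 h) ^ Suc (Suc n) / h) \<longlongrightarrow> 0) (at (0::real))"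
  proof (rule Lim_null_comparison[where g="\<lambda>h. \<bar>h\<bar> ^ Suc n"])
    show "\<forall>\<^sub>F h in at (0::real). norm ((max 0 h) ^ Suc (Suc n) / h) \<le> \<bar>h\<bar> ^ Suc n"
      by (intro always_eventually allI) (auto simp: max_def abs_mult power_abs intro: mult_nonpos_nonneg)
    show "((\<lambda>h. \<bar>h\<bar> ^ Suc n) \<longlongrightarrow> 0) (at (0::real))"
      by (rule tendsto_eq_intros | simp)+
  qed
  then show ?thesis using True by (simp add: DERIV_def)
next
  case False
  then consider "s < 0" | "s > 0" by linarith
  then show ?thesis
  proof cases
    case 1
    have "((\<lambda>s. 0) has_real_derivative 0) (at s)" by simp
    then have "((\<lambda>s. (max 0 s) ^ Suc (Suc n)) has_real_derivative 0) (at s)"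
      by (rule has_field_derivative_transform_within_open[where S="{..<0}"]) (use 1 in auto)
    then show ?thesis using 1 by simp
  next
    case 2
    have "((\<lambda>s. s ^ Suc (Suc n)) has_real_derivative real (Suc (Suc n)) * s ^ Suc n) (at s)"
      by (rule derivative_eq_intros | simp)+
    then have "((\<lambda>s. (max 0 s) ^ Suc (Suc n)) has_real_derivative real (Suc (Suc n)) * s ^ Suc n) (at s)"
      by (rule has_field_derivative_transform_within_open[where S="{0<..}"]) (use 2 in auto)
    then show ?thesis using 2 by simp
  qed
qed

lemma Ck_on_pos_part_power: "Ck_on k UNIV (\<lambda>s::real. (max 0 s) ^ Suc k)"
proof (induction k)
  case 0
  then show ?case by (auto intro!: continuous_intros)
next
  case (Suc k)
  show ?case
    by (rule Ck_on_one_real[where f'="\<lambda>s. real (Suc (Suc k)) * (max 0 s) ^ Suc k"])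
      (use Suc in \<open>auto intro!: Ck_on_bounded_linear[OF bounded_linear_mult_right] simp del: power_Suc of_nat_Suc
        simp: has_real_derivative_iff_has_vector_derivative[symmetric] has_real_derivative_pos_part_power\<close>)
qed

lemma Ck_on_C2_step: "Ck_on 2 UNIV C2_step"
proof -
  have g: "Ck_on 2 UNIV (\<lambda>s::real. (max 0 s) ^ 3)"
    using Ck_on_pos_part_power[of 2] by (simp add: numeral_3_eq_3 numeral_2_eq_2)
  have "Ck_on 2 UNIV (\<lambda>s::real. 1 - (max 0 s) ^ 3)"
    by (intro Ck_on_diff Ck_on_const g) auto
  from Ck_on_compose[OF _ _ _ g this]
  have "Ck_on 2 UNIV (\<lambda>s::real. (max 0 (1 - (max 0 s) ^ 3)) ^ 3)" by simp
  then have "Ck_on 2 UNIV (\<lambda>s::real. 1 - (max 0 (1 - (max 0 s) ^ 3)) ^ 3)"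
    by (intro Ck_on_diff Ck_on_const) auto
  then show ?thesis unfolding C2_step_def[abs_def] .
qed

section \<open>\<open>C\<^sup>k\<close> maps into a Lie group and \<open>C\<^sup>k\<close> functions on it\<close>

text \<open>For open \<open>S\<close>, this is the counterpart of \<^const>\<open>smooth_curve\<close> for maps that depend on
  several variables.  Sums of such maps and their compositions with functions on the group
  are again \<open>C\<^sup>k\<close>, so that charts can be left out of most later arguments.\<close>

definition Ck_into ::
  "('g::topological_space, 'e::euclidean_space) chart set \<Rightarrow> nat \<Rightarrow> 'a::real_normed_vector set \<Rightarrow> ('a \<Rightarrow> 'g) \<Rightarrow> bool" where
  "Ck_into A k S F \<longleftrightarrow>
     continuous_on S F \<and> (\<forall>(U, c)\<in>A. Ck_on k {x\<in>S. F x \<in> U} (\<lambda>x. c (F x)))"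

context lie_group
begin

lemma
  assumes "(U, c) \<in> A"
  shows chart_open: "open U" and chart_image_open: "open (c ` U)"
    and chart_continuous: "continuous_on U c"
    and chart_inv_continuous: "continuous_on (c ` U) (inv_into U c)"
    and chart_inv: "x \<in> U \<Longrightarrow> inv_into U c (c x) = x"
  using atlas assms unfolding smooth_atlas_def homeomorphism_def by blast+

lemma chart_right_inv: "y \<in> c ` U \<Longrightarrow> c (inv_into U c y) = y"
  by (rule f_inv_into_f)

lemma chart_at:
  obtains U c where "(U, c) \<in> A" "p \<in> U"
  using atlas unfolding smooth_atlas_def by blast

lemma chart_transition:
  assumes "(U, c) \<in> A" "(W, d) \<in> A"
  shows "Ck_on k (c ` (U \<inter> W)) (\<lambda>x. d (inv_into U c x))"
  using atlas assms unfolding smooth_atlas_def smooth_on_def comp_def by fast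

lemma chart_image_open_subset:
  assumes "(U, c) \<in> A" "open N"
  shows "open (c ` (U \<inter> N))"
proof -
  have "c ` (U \<inter> N) = c ` U \<inter> inv_into U c -` N"
    using chart_inv[OF assms(1)] by (auto simp: image_iff)
  then show ?thesis
    using continuous_open_preimage[OF chart_inv_continuous[OF assms(1)] chart_image_open[OF assms(1)] assms(2)]
    by simp
qed

text \<open>Since the transition maps are smooth, a single chart around each value suffices.\<close>

lemma Ck_into_local:
  assumes "\<And>x. x \<in> S \<Longrightarrow> \<exists>(U, c)\<in>A. \<exists>T. open T \<and> x \<in> T \<and> F ` T \<subseteq> U \<and> Ck_on k T (\<lambda>x. c (F x))"
  shows "Ck_into A k S F"
  unfolding Ck_into_def
proof (intro conjI)
  have loc: "continuous_on T F" if "(U, c) \<in> A" "F ` T \<subseteq> U" "Ck_on k T (\<lambda>x. c (F x))" for T U c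
  proof (rule continuous_on_eq)
    show "continuous_on T (\<lambda>x. inv_into U c (c (F x)))"
      by (rule continuous_on_compose2[OF chart_inv_continuous[OF that(1)] Ck_on_continuous[OF that(3)]])
        (use that in auto)
    show "inv_into U c (c (F x)) = F x" if "x \<in> T" for x
      using that \<open>F ` T \<subseteq> U\<close> by (intro chart_inv[OF \<open>(U, c) \<in> A\<close>]) auto
  qed
  show "continuous_on S F"
  proof (intro continuous_at_imp_continuous_on ballI)
    fix x assume "x \<in> S"
    from assms[OF this] obtain U c T where "(U, c) \<in> A" "open T" "x \<in> T" "F ` T \<subseteq> U"
      "Ck_on k T (\<lambda>x. c (F x))" by blast
    with loc[of U c T] show "isCont F x" by (simp add: continuous_on_eq_continuous_at)
  qed
  show "\<forall>(W, d)\<in>A. Ck_on k {x \<in> S. F x \<in> W} (\<lambda>x. d (F x))"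
  proof clarify
    fix W d assume W: "(W, d) \<in> A"
    show "Ck_on k {x \<in> S. F x \<in> W} (\<lambda>x. d (F x))"
    proof (rule Ck_on_local)
      fix x assume x: "x \<in> {x \<in> S. F x \<in> W}"
      with assms[of x] obtain U c T where U: "(U, c) \<in> A" "F ` T \<subseteq> U" "Ck_on k T (\<lambda>x. c (F x))"
        and T: "open T" "x \<in> T" by blast
      let ?T = "T \<inter> F -` W"
      have op: "open ?T"
        by (rule continuous_open_preimage[OF loc[OF U] T(1) chart_open[OF W]])
      have "Ck_on k ?T (\<lambda>x. d (inv_into U c (c (F x))))"
        by (rule Ck_on_compose[OF op chart_image_open_subset[OF U(1) chart_open[OF W]] _
              chart_transition[OF U(1) W] Ck_on_subset[OF U(3)]]) (use U in auto)
      then have "Ck_on k ?T (\<lambda>x. d (F x))"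
        by (rule Ck_on_cong[OF op, rotated]) (use U chart_inv in auto)
      with op T x show "\<exists>T. open T \<and> x \<in> T \<and> Ck_on k T (\<lambda>x. d (F x))" by blast
    qed
  qed
qed

lemma Ck_into_preimage_open: "Ck_into A k S F \<Longrightarrow> open S \<Longrightarrow> open W \<Longrightarrow> open {x\<in>S. F x \<in> W}"
  unfolding Ck_into_def using continuous_open_preimage[of S F W] by (simp add: vimage_def Int_def)

lemma Ck_into_chart: "Ck_into A k S F \<Longrightarrow> (U, c) \<in> A \<Longrightarrow> Ck_on k {x\<in>S. F x \<in> U} (\<lambda>x. c (F x))"
  unfolding Ck_into_def by blast

lemma Ck_into_subset: "Ck_into A k S F \<Longrightarrow> T \<subseteq> S \<Longrightarrow> Ck_into A k T F"
  unfolding Ck_into_def by (force intro: continuous_on_subset Ck_on_subset)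

lemma Ck_into_const: "Ck_into A k S (\<lambda>x. p)"
proof -
  obtain U c where "(U, c) \<in> A" "p \<in> U" by (rule chart_at)
  then show ?thesis
    by (intro Ck_into_local bexI[of _ "(U, c)"]) (auto intro!: exI[of _ UNIV] Ck_on_const)
qed

lemma Ck_into_inv_chart:
  assumes "(U, c) \<in> A"
  shows "Ck_into A k (c ` U) (inv_into U c)"
proof -
  have "Ck_on k (c ` U) (\<lambda>x. c (inv_into U c x))"
    by (rule Ck_on_cong[OF chart_image_open[OF assms] _ Ck_on_bounded_linear_fun[OF bounded_linear_ident]])
      (simp add: chart_right_inv)
  then show ?thesis
    by (intro Ck_into_local bexI[OF _ assms])
      (use chart_image_open[OF assms] in \<open>auto intro!: exI[of _ "c ` U"] simp: inv_into_into\<close>)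
qed

lemma Ck_into_compose:
  fixes h :: "'a::real_normed_vector \<Rightarrow> 'b::euclidean_space"
  assumes "open S" "open T" "\<And>x. x \<in> T \<Longrightarrow> h x \<in> S" "Ck_into A k S F" "Ck_on k T h"
  shows "Ck_into A k T (\<lambda>x. F (h x))"
  unfolding Ck_into_def
proof (intro conjI, goal_cases)
  case 1
  show ?case
    by (rule continuous_on_compose2[OF _ Ck_on_continuous[OF assms(5)]])
      (use assms in \<open>auto simp: Ck_into_def\<close>)
next
  case 2
  show ?case
  proof clarify
    fix U c assume U: "(U, c) \<in> A"
    have op: "open {x\<in>S. F x \<in> U}"
      by (rule Ck_into_preimage_open[OF assms(4,1) chart_open[OF U]])
    have op': "open {x \<in> T. F (h x) \<in> U}"
    proof -
      have "{x \<in> T. F (h x) \<in> U} = T \<inter> h -` {x\<in>S. F x \<in> U}" using assms(3) by auto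
      then show ?thesis
        using continuous_open_preimage[OF Ck_on_continuous[OF assms(5)] assms(2) op] by simp
    qed
    show "Ck_on k {x \<in> T. F (h x) \<in> U} (\<lambda>x. c (F (h x)))"
      by (rule Ck_on_compose[OF op' op _ Ck_into_chart[OF assms(4) U] Ck_on_subset[OF assms(5)]])
        (use assms in auto)
  qed
qed

lemma chart_product_open:
  assumes U: "(U, c) \<in> A" and V: "(V, d) \<in> A" and W: "open W"
  shows "open {(x, y) \<in> (c ` U) \<times> (d ` V). inv_into U c x + inv_into V d y \<in> W}"
proof -
  have "continuous_on ((c ` U) \<times> (d ` V)) (\<lambda>z. inv_into U c (fst z) + inv_into V d (snd z))"
    by (intro continuous_on_add continuous_on_compose2[OF chart_inv_continuous[OF U]]
        continuous_on_compose2[OF chart_inv_continuous[OF V]]) (auto intro!: continuous_intros)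
  from continuous_open_preimage[OF this _ W] show ?thesis
    using open_Times[OF chart_image_open[OF U] chart_image_open[OF V]]
    by (simp add: vimage_def Int_def case_prod_unfold mem_Times_iff conj_assoc)
qed

lemma Ck_into_add:
  assumes S: "open S" and F: "Ck_into A k S F" and G: "Ck_into A k S G"
  shows "Ck_into A k S (\<lambda>x. F x + G x)"
proof (rule Ck_into_local)
  fix x assume x: "x \<in> S"
  obtain U c where U: "(U, c) \<in> A" "F x \<in> U" by (rule chart_at)
  obtain V d where V: "(V, d) \<in> A" "G x \<in> V" by (rule chart_at)
  obtain W b where W: "(W, b) \<in> A" "F x + G x \<in> W" by (rule chart_at)
  let ?M = "{(x, y) \<in> (c ` U) \<times> (d ` V). inv_into U c x + inv_into V d y \<in> W}"
  have M: "open ?M" by (rule chart_product_open[OF U(1) V(1) chart_open[OF W(1)]])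
  define T where "T = {x\<in>S. F x \<in> U} \<inter> ({x\<in>S. G x \<in> V} \<inter> {x\<in>S. F x + G x \<in> W})"
  have "continuous_on S (\<lambda>x. F x + G x)"
    using F G by (auto simp: Ck_into_def intro: continuous_on_add)
  from continuous_open_preimage[OF this S chart_open[OF W(1)]]
  have "open {x\<in>S. F x + G x \<in> W}" by (simp add: vimage_def Int_def)
  then have T: "open T"
    unfolding T_def
    using Ck_into_preimage_open[OF F S chart_open[OF U(1)]] Ck_into_preimage_open[OF G S chart_open[OF V(1)]]
    by blast
  have "Ck_on k T (\<lambda>x. (\<lambda>(x, y). b (inv_into U c x + inv_into V d y)) (c (F x), d (G x)))"
  proof (rule Ck_on_compose[OF T M])
    show "Ck_on k T (\<lambda>x. (c (F x), d (G x)))"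
      by (intro Ck_on_Pair[OF T] Ck_on_subset[OF Ck_into_chart[OF F U(1)]]
          Ck_on_subset[OF Ck_into_chart[OF G V(1)]]) (auto simp: T_def)
    show "Ck_on k ?M (\<lambda>(x, y). b (inv_into U c x + inv_into V d y))"
      using mult_smooth[OF U(1) V(1) W(1)] by (simp add: smooth_on_def)
  qed (use chart_inv[OF U(1)] chart_inv[OF V(1)] in \<open>auto simp: T_def\<close>)
  then have "Ck_on k T (\<lambda>x. b (F x + G x))"
    by (rule Ck_on_cong[OF T, rotated]) (use chart_inv[OF U(1)] chart_inv[OF V(1)] in \<open>auto simp: T_def\<close>)
  then show "\<exists>(W, b)\<in>A. \<exists>T. open T \<and> x \<in> T \<and> (\<lambda>x. F x + G x) ` T \<subseteq> W \<and> Ck_on k T (\<lambda>x. b (F x + G x))"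
    using T x U V W by (intro bexI[OF _ W(1)]) (auto intro!: exI[of _ T] simp: T_def)
qed

lemma Ck_fun_compose:
  assumes f: "Ck_fun A k W f" and W: "open W" and F: "Ck_into A k S F" and S: "open S"
    and sub: "\<And>x. x \<in> S \<Longrightarrow> F x \<in> W"
  shows "Ck_on k S (\<lambda>x. f (F x))"
proof (rule Ck_on_local)
  fix x assume x: "x \<in> S"
  obtain U c where U: "(U, c) \<in> A" "F x \<in> U" by (rule chart_at)
  let ?T = "{x\<in>S. F x \<in> U}"
  have T: "open ?T" by (rule Ck_into_preimage_open[OF F S chart_open[OF U(1)]])
  have f': "Ck_on k (c ` (U \<inter> W)) (\<lambda>y. f (inv_into U c y))"
    using f U(1) unfolding Ck_fun_def comp_def by fast
  have "Ck_on k ?T (\<lambda>x. f (inv_into U c (c (F x))))"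
    by (rule Ck_on_compose[OF T chart_image_open_subset[OF U(1) W] _ f' Ck_into_chart[OF F U(1)]])
      (use sub in auto)
  then have "Ck_on k ?T (\<lambda>x. f (F x))"
    by (rule Ck_on_cong[OF T, rotated]) (use chart_inv[OF U(1)] in auto)
  with T x U(2) show "\<exists>T. open T \<and> x \<in> T \<and> Ck_on k T (\<lambda>x. f (F x))" by blast
qed

lemma Ck_funI:
  assumes "\<And>p. p \<in> W \<Longrightarrow> \<exists>(U, c)\<in>A. \<exists>N. open N \<and> p \<in> N \<and> N \<subseteq> U \<and>
             Ck_on k (c ` N) (\<lambda>y. f (inv_into U c y))"
  shows "Ck_fun A k W f"
  unfolding Ck_fun_def comp_def
proof clarify
  fix V d assume V: "(V, d) \<in> A"
  show "Ck_on k (d ` (V \<inter> W)) (\<lambda>y. f (inv_into V d y))"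
  proof (rule Ck_on_local)
    fix y assume "y \<in> d ` (V \<inter> W)"
    then obtain p where p: "p \<in> V" "p \<in> W" "y = d p" by blast
    from assms[OF p(2)] obtain U c N where U: "(U, c) \<in> A"
      and N: "open N" "p \<in> N" "N \<subseteq> U" "Ck_on k (c ` N) (\<lambda>y. f (inv_into U c y))"
      by blast
    have op: "open (d ` (V \<inter> N))" by (rule chart_image_open_subset[OF V N(1)])
    have opc: "open (c ` N)" using chart_image_open_subset[OF U N(1)] N(3) by (simp add: Int_absorb1)
    have "Ck_on k (d ` (V \<inter> N)) (\<lambda>y. f (inv_into U c (c (inv_into V d y))))"
      by (rule Ck_on_compose[OF op opc _ N(4) Ck_on_subset[OF chart_transition[OF V U]]])
        (use chart_inv[OF V] N(3) in auto)
    then have "Ck_on k (d ` (V \<inter> N)) (\<lambda>y. f (inv_into V d y))"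
      by (rule Ck_on_cong[OF op, rotated]) (use chart_inv[OF V] chart_inv[OF U] N(3) in \<open>auto simp: subset_iff\<close>)
    with op p N(2) show "\<exists>T. open T \<and> y \<in> T \<and> Ck_on k T (\<lambda>y. f (inv_into V d y))" by blast
  qed
qed

lemma Ck_fun_translate:
  assumes f: "Ck_fun A k W f" and W: "open W"
  shows "Ck_fun A k {x. a + x \<in> W} (\<lambda>x. f (a + x))"
  unfolding Ck_fun_def comp_def
proof clarify
  fix U c assume U: "(U, c) \<in> A"
  have "open {x. a + x \<in> W}"
    using open_vimage[OF W, of "\<lambda>x. a + x"] by (simp add: vimage_def continuous_on_add)
  then have op: "open (c ` (U \<inter> {x. a + x \<in> W}))" by (rule chart_image_open_subset[OF U])
  have "Ck_into A k (c ` (U \<inter> {x. a + x \<in> W})) (\<lambda>y. a + inv_into U c y)"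
    by (intro Ck_into_add[OF op] Ck_into_const Ck_into_subset[OF Ck_into_inv_chart[OF U]]) auto
  from Ck_fun_compose[OF f W this op]
  show "Ck_on k (c ` (U \<inter> {x. a + x \<in> W})) (\<lambda>y. f (a + inv_into U c y))"
    by (rule meta_mp) (use chart_inv[OF U] in auto)
qed

lemma Ck_fun_translate_UNIV: "Ck_fun A k UNIV f \<Longrightarrow> Ck_fun A k UNIV (\<lambda>x. f (a + x))"
  using Ck_fun_translate[of k UNIV f a] by simp

lemma Ck_fun_le: "Ck_fun A n W f \<Longrightarrow> k \<le> n \<Longrightarrow> Ck_fun A k W f"
  unfolding Ck_fun_def by (fast intro: Ck_on_le)

lemma Ck_fun_UNIV_C1_near: "Ck_fun A 1 UNIV f \<Longrightarrow> C1_near A p f"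
  unfolding C1_near_def by blast

lemma Ck_fun_lincomb:
  assumes "\<And>i. i \<in> I \<Longrightarrow> Ck_fun A k UNIV (f i)"
  shows "Ck_fun A k UNIV (\<lambda>x. \<Sum>i\<in>I. a i * f i x)"
  unfolding Ck_fun_def comp_def
proof clarify
  fix U c assume U: "(U, c) \<in> A"
  have "Ck_on k (c ` (U \<inter> UNIV)) (\<lambda>y. f i (inv_into U c y))" if "i \<in> I" for i
    using assms[OF that] U unfolding Ck_fun_def comp_def by fast
  then show "Ck_on k (c ` (U \<inter> UNIV)) (\<lambda>y. \<Sum>i\<in>I. a i * f i (inv_into U c y))"
    using chart_image_open[OF U] by (intro Ck_on_sum Ck_on_mult Ck_on_const) auto
qed

text \<open>Test functions for v-convexity have to be \<open>C\<^sup>2\<close> on the whole group, whereas the natural ones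
  exist only near one point.  A cutoff in a chart extends them by zero; closedness of a compact
  set in a Hausdorff space makes the extension \<open>C\<^sup>2\<close> across the boundary of the chart domain.\<close>

lemma Ck_fun_local_extension:
  assumes U: "(U, c) \<in> A" and N: "open N" "N \<subseteq> c ` U" "y0 \<in> N" and F: "Ck_on 2 N F"
  shows "\<exists>\<phi>. Ck_fun A 2 UNIV \<phi> \<and> (\<forall>\<^sub>F x in nhds (inv_into U c y0). \<phi> x = F (c x))"
proof -
  obtain \<rho> where \<rho>: "\<rho> > 0" "ball y0 (2 * \<rho>) \<subseteq> N"
  proof -
    from N obtain e where "e > 0" "ball y0 e \<subseteq> N" by (auto simp: open_contains_ball)
    then show ?thesis by (intro that[of "e / 2"]) auto
  qed
  \<comment> \<open>The argument is at least 1 for \<open>|y - y0| \<le> \<rho>\<close> and at most 0 for \<open>|y - y0| \<ge> \<surd>2 \<rho>\<close>; note that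
    \<open>\<surd>2 < 3/2 < 2\<close>, so that \<open>cut\<close> vanishes well inside the ball of radius \<open>2 \<rho>\<close>.\<close>
  define cut where "cut y = C2_step (2 - ((y - y0) \<bullet> (y - y0)) / \<rho>\<^sup>2)" for y
  have cut: "Ck_on 2 S cut" if "open S" for S
  proof -
    have "Ck_on 2 S (\<lambda>y. 2 - (inverse (\<rho>\<^sup>2)) * ((y - y0) \<bullet> (y - y0)))"
      by (intro Ck_on_diff Ck_on_const Ck_on_mult Ck_on_inner that Ck_on_bounded_linear_fun bounded_linear_ident)
    from Ck_on_compose[OF that open_UNIV _ Ck_on_C2_step this]
    show ?thesis unfolding cut_def[abs_def] by (simp add: divide_inverse mult.commute)
  qed
  have sq: "(dist y0 y)\<^sup>2 = (y - y0) \<bullet> (y - y0)" for y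
    by (metis dist_commute dist_norm power2_norm_eq_inner)
  have cut0: "cut y = 0" if "dist y0 y \<ge> 3/2 * \<rho>" for y
  proof -
    have "(3/2 * \<rho>)\<^sup>2 \<le> (dist y0 y)\<^sup>2" using that \<rho>(1) by (intro power_mono) auto
    moreover have "2 * \<rho>\<^sup>2 \<le> (3/2 * \<rho>)\<^sup>2" by (simp add: power_mult_distrib power2_eq_square)
    ultimately have "2 * \<rho>\<^sup>2 \<le> (y - y0) \<bullet> (y - y0)" by (simp add: sq)
    then show ?thesis unfolding cut_def using \<rho>(1) by (intro C2_step_le_0) (simp add: field_simps)
  qed
  have cut1: "cut y = 1" if "dist y0 y < \<rho>" for y
  proof -
    have "(dist y0 y)\<^sup>2 \<le> \<rho>\<^sup>2" using that by (intro power_mono) auto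
    then have "(y - y0) \<bullet> (y - y0) \<le> \<rho>\<^sup>2" by (simp add: sq)
    then show ?thesis unfolding cut_def using \<rho>(1) by (intro C2_step_ge_1) (simp add: field_simps)
  qed
  define \<phi> where "\<phi> x = (if x \<in> U \<and> c x \<in> N then cut (c x) * F (c x) else 0)" for x
  let ?B = "inv_into U c ` cball y0 (3/2 * \<rho>)"
  have cb: "cball y0 (3/2 * \<rho>) \<subseteq> ball y0 (2 * \<rho>)" using \<rho>(1) by auto
  have "compact ?B"
    by (intro compact_continuous_image continuous_on_subset[OF chart_inv_continuous[OF U]])
      (use cb \<rho>(2) N(2) in auto)
  then have closed: "closed ?B" by (rule compact_imp_closed)
  have "Ck_fun A 2 UNIV \<phi>"
  proof (rule Ck_funI)
    fix p
    show "\<exists>(U, c)\<in>A. \<exists>N. open N \<and> p \<in> N \<and> N \<subseteq> U \<and> Ck_on 2 (c ` N) (\<lambda>y. \<phi> (inv_into U c y))"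
    proof (cases "p \<in> ?B")
      case False
      obtain V d where V: "(V, d) \<in> A" "p \<in> V" by (rule chart_at)
      have zero: "\<phi> x = 0" if "x \<notin> ?B" for x
      proof (cases "x \<in> U \<and> c x \<in> N")
        case True
        then have "c x \<notin> cball y0 (3/2 * \<rho>)" 
          using that chart_inv[OF U, of x] image_eqI[of x "inv_into U c" "c x" "cball y0 (3/2 * \<rho>)"] by auto
        then show ?thesis by (simp add: \<phi>_def cut0)
      qed (auto simp: \<phi>_def)
      have "Ck_on 2 (d ` (V \<inter> - ?B)) (\<lambda>y. \<phi> (inv_into V d y))"
        by (rule Ck_on_cong[OF chart_image_open_subset[OF V(1)] _ Ck_on_const[where a=0]])
          (use closed zero chart_inv[OF V(1)] in \<open>auto simp: open_Compl\<close>)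
      then show ?thesis
        using V False closed chart_open[OF V(1)]
        by (intro bexI[OF _ V(1)]) (auto intro!: exI[of _ "V \<inter> - ?B"] open_Int open_Compl)
    next
      case True
      let ?N = "U \<inter> c -` ball y0 (2 * \<rho>)"
      have opN: "open ?N"
        by (rule continuous_open_preimage[OF chart_continuous[OF U] chart_open[OF U] open_ball])
      have im: "c ` ?N = ball y0 (2 * \<rho>)" using \<rho>(2) N(2) by auto
      have "Ck_on 2 (ball y0 (2 * \<rho>)) (\<lambda>y. cut y * F y)"
        by (intro Ck_on_mult cut Ck_on_subset[OF F]) (use \<rho> in auto)
      then have "Ck_on 2 (ball y0 (2 * \<rho>)) (\<lambda>y. \<phi> (inv_into U c y))"
        by (rule Ck_on_cong[OF open_ball, rotated])
          (use \<rho>(2) N(2) in \<open>auto simp: \<phi>_def chart_right_inv inv_into_into subset_iff\<close>)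
      moreover have "p \<in> ?N" using True cb \<rho>(2) N(2)
        by (force simp: chart_right_inv inv_into_into subset_iff)
      ultimately show ?thesis using opN im by (intro bexI[OF _ U]) (auto intro!: exI[of _ ?N])
    qed
  qed
  moreover have "\<forall>\<^sub>F x in nhds (inv_into U c y0). \<phi> x = F (c x)"
  proof -
    let ?N = "U \<inter> c -` ball y0 \<rho>"
    have "open ?N"
      by (rule continuous_open_preimage[OF chart_continuous[OF U] chart_open[OF U] open_ball])
    moreover have "inv_into U c y0 \<in> ?N"
      using N \<rho>(1) by (auto simp: chart_right_inv inv_into_into subset_iff)
    moreover have "\<phi> x = F (c x)" if "x \<in> ?N" for x
      using that \<rho> by (auto simp: \<phi>_def cut1 subset_iff)
    ultimately show ?thesis unfolding eventually_nhds by blast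
  qed
  ultimately show ?thesis by blast
qed

lemma C1_near_chain_rule:
  assumes f: "C1_near A p f" and U: "(U, c) \<in> A" "p \<in> U"
    and \<zeta>: "open I" "t \<in> I" "\<zeta> t = p" "\<And>s. s \<in> I \<Longrightarrow> \<zeta> s \<in> U"
    and w: "((\<lambda>s. c (\<zeta> s)) has_vector_derivative w) (at t)"
  shows "((\<lambda>s. f (\<zeta> s)) has_real_derivative frechet_derivative (\<lambda>y. f (inv_into U c y)) (at (c p)) w) (at t)"
proof -
  obtain W where W: "open W" "p \<in> W" "Ck_fun A 1 W f" using f unfolding C1_near_def by blast
  then have "Ck_on 1 (c ` (U \<inter> W)) (\<lambda>y. f (inv_into U c y))"
    using U(1) unfolding Ck_fun_def comp_def by fast
  then have "((\<lambda>y. f (inv_into U c y)) has_derivative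
      frechet_derivative (\<lambda>y. f (inv_into U c y)) (at (c p))) (at (c (\<zeta> t)))"
    unfolding \<zeta>(3) One_nat_def by (rule Ck_on_has_derivative) (use U(2) W(2) in blast)
  from vector_derivative_diff_chain_within[OF w has_derivative_at_withinI[OF this]]
  have "((\<lambda>s. f (inv_into U c (c (\<zeta> s)))) has_vector_derivative
      frechet_derivative (\<lambda>y. f (inv_into U c y)) (at (c p)) w) (at t)"
    by (simp add: comp_def)
  then have "((\<lambda>s. f (\<zeta> s)) has_vector_derivative
      frechet_derivative (\<lambda>y. f (inv_into U c y)) (at (c p)) w) (at t)"
    by (rule has_vector_derivative_transform_within_open[OF _ \<zeta>(1,2)])
      (use \<zeta>(4) chart_inv[OF U(1)] in auto)
  then show ?thesis by (simp add: has_real_derivative_iff_has_vector_derivative)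
qed

text \<open>A tangent vector was introduced as an operator on functions; in a chart it is the derivative in
  the direction of an honest vector \<open>w\<close>.\<close>

lemma tangent_vector_in_chart:
  assumes T: "T \<in> tangent_space A p" and U: "(U, c) \<in> A" "p \<in> U"
  obtains w where "\<And>f. C1_near A p f \<Longrightarrow> T f = frechet_derivative (\<lambda>y. f (inv_into U c y)) (at (c p)) w"
    and "\<And>f. \<not> C1_near A p f \<Longrightarrow> T f = 0"
proof -
  from T obtain \<sigma> \<epsilon> where \<sigma>: "T = (\<lambda>f. if C1_near A p f then deriv (\<lambda>t. f (\<sigma> t)) 0 else 0)"
    "\<sigma> 0 = p" "\<epsilon> > 0" "smooth_curve A {-\<epsilon><..<\<epsilon>} \<sigma>"
    unfolding tangent_space_def by blast
  let ?I = "{t\<in>{-\<epsilon><..<\<epsilon>}. \<sigma> t \<in> U}"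
  have "Ck_on 1 ?I (\<lambda>t. c (\<sigma> t))"
    using \<sigma>(4) U(1) unfolding smooth_curve_def smooth_on_def comp_def by fast
  then have "(\<lambda>t. c (\<sigma> t)) differentiable at 0"
    using \<sigma>(2,3) U(2) by (intro Ck_on_differentiable[where S="?I" and k=1]) auto
  then obtain w where w: "((\<lambda>t. c (\<sigma> t)) has_vector_derivative w) (at 0)"
    by (metis vector_derivative_works)
  have I: "open ?I"
    using \<sigma>(4) chart_open[OF U(1)] continuous_open_preimage[of "{-\<epsilon><..<\<epsilon>}" \<sigma> U]
    by (simp add: smooth_curve_def vimage_def Int_def)
  show thesis
  proof (rule that)
    fix f assume f: "C1_near A p f"
    then have "((\<lambda>t. f (\<sigma> t)) has_real_derivative
        frechet_derivative (\<lambda>y. f (inv_into U c y)) (at (c p)) w) (at 0)"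
      using \<sigma>(2,3) U(2) by (intro C1_near_chain_rule[OF _ U I _ _ _ w]) auto
    then show "T f = frechet_derivative (\<lambda>y. f (inv_into U c y)) (at (c p)) w"
      using f \<sigma>(1) by (simp add: DERIV_imp_deriv)
  qed (use \<sigma>(1) in simp)
qed

end

section \<open>Autonomous differential equations\<close>

lemma onorm_le_sum_Basis:
  fixes f :: "'a::euclidean_space \<Rightarrow> 'b::real_normed_vector"
  assumes "linear f"
  shows "onorm f \<le> (\<Sum>b\<in>Basis. norm (f b))"
proof (rule onorm_le)
  fix x
  have "f x = (\<Sum>b\<in>Basis. (x \<bullet> b) *\<^sub>R f b)"
    using linear_sum[OF assms, of "\<lambda>b. (x \<bullet> b) *\<^sub>R b" Basis]
    by (simp add: euclidean_representation linear_cmul[OF assms])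
  also have "norm \<dots> \<le> (\<Sum>b\<in>Basis. norm (f b) * norm x)"
    by (rule sum_norm_le) (subst mult.commute, simp add: mult_right_mono Basis_le_norm)
  finally show "norm (f x) \<le> (\<Sum>b\<in>Basis. norm (f b)) * norm x" by (simp add: sum_distrib_right)
qed

lemma C1_locally_Lipschitz:
  fixes f :: "'a::euclidean_space \<Rightarrow> 'b::real_normed_vector"
  assumes "open S" "Ck_on 1 S f" "x0 \<in> S"
  obtains \<rho> L where "\<rho> > 0" "L > 0" "cball x0 \<rho> \<subseteq> S"
    "\<And>x y. x \<in> cball x0 \<rho> \<Longrightarrow> y \<in> cball x0 \<rho> \<Longrightarrow> norm (f x - f y) \<le> L * norm (x - y)"
proof -
  from assms obtain \<rho> where \<rho>: "\<rho> > 0" "cball x0 \<rho> \<subseteq> S" by (meson open_contains_cball)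
  let ?g = "\<lambda>x. \<Sum>b\<in>Basis. norm (frechet_derivative f (at x) b)"
  have "continuous_on (cball x0 \<rho>) ?g"
    using assms(2) by (auto intro!: continuous_intros intro: continuous_on_subset[OF _ \<rho>(2)])
  then have "bounded (?g ` cball x0 \<rho>)"
    by (intro compact_imp_bounded compact_continuous_image) auto
  then obtain L where L: "L > 0" "\<And>x. x \<in> cball x0 \<rho> \<Longrightarrow> norm (?g x) \<le> L"
    by (auto simp: bounded_pos)
  have "norm (f x - f y) \<le> L * norm (x - y)" if xy: "x \<in> cball x0 \<rho>" "y \<in> cball x0 \<rho>" for x y
  proof (rule differentiable_bound[OF convex_cball _ _ xy])
    fix z assume z: "z \<in> cball x0 \<rho>"
    show "(f has_derivative frechet_derivative f (at z)) (at z within cball x0 \<rho>)"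
      using assms(2)[unfolded One_nat_def] \<rho>(2) z
      by (blast intro: has_derivative_at_withinI Ck_on_has_derivative)
    have "linear (frechet_derivative f (at z))"
      using \<rho>(2) z by (intro linear_frechet_derivative Ck_on_differentiable[OF assms(2)]) auto
    from onorm_le_sum_Basis[OF this] L(2)[OF z]
    show "onorm (frechet_derivative f (at z)) \<le> L" by simp
  qed
  with \<rho> L show thesis by (intro that)
qed

lemma vector_derivative_bound:
  fixes f :: "real \<Rightarrow> 'a::real_normed_vector"
  assumes "\<And>t. t \<in> {a..b} \<Longrightarrow> (f has_vector_derivative f' t) (at t within {a..b})"
    and "\<And>t. t \<in> {a..b} \<Longrightarrow> norm (f' t) \<le> B" and "s \<in> {a..b}" "t \<in> {a..b}"
  shows "norm (f t - f s) \<le> B * \<bar>t - s\<bar>"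
proof -
  have "norm (f t - f s) \<le> B * norm (t - s)"
  proof (rule differentiable_bound[OF _ _ _ assms(4,3)])
    show "(f has_derivative (\<lambda>h. h *\<^sub>R f' x)) (at x within {a..b})" if "x \<in> {a..b}" for x
      using assms(1)[OF that] by (simp add: has_vector_derivative_def)
    show "onorm (\<lambda>h. h *\<^sub>R f' x) \<le> B" if "x \<in> {a..b}" for x
      using assms(2)[OF that] by (intro onorm_le) (subst mult.commute, simp add: mult_left_mono)
  qed simp
  then show ?thesis by simp
qed

text \<open>For \<open>\<bar>t\<bar> \<le> h\<close> the maximum \<open>M\<close> of the distance between two
  solutions satisfies \<open>M \<le> L h M\<close> by the mean value theorem, and
  \<open>L h < 1\<close> forces \<open>M = 0\<close>.\<close>

lemma ode_unique:
  fixes x y :: "real \<Rightarrow> 'a::real_normed_vector"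
  assumes Lip: "\<And>a b. a \<in> B \<Longrightarrow> b \<in> B \<Longrightarrow> norm (X a - X b) \<le> L * norm (a - b)"
    and h: "h > 0" "L * h < 1" "L > 0"
    and x: "\<And>t. \<bar>t\<bar> \<le> h \<Longrightarrow> x t \<in> B \<and> (x has_vector_derivative X (x t)) (at t)"
    and y: "\<And>t. \<bar>t\<bar> \<le> h \<Longrightarrow> y t \<in> B \<and> (y has_vector_derivative X (y t)) (at t)"
    and eq: "x 0 = y 0" and t: "\<bar>t\<bar> \<le> h"
  shows "x t = y t"
proof -
  let ?d = "\<lambda>t. x t - y t"
  have d: "(?d has_vector_derivative X (x t) - X (y t)) (at t within {-h..h})" if "t \<in> {-h..h}" for t
    using that x[of t] y[of t]
    by (intro has_vector_derivative_diff) (simp_all add: abs_le_iff has_vector_derivative_at_within)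
  have "continuous_on {-h..h} (\<lambda>t. norm (?d t))"
    using has_vector_derivative_continuous[OF d]
    by (intro continuous_on_norm) (simp add: continuous_on_eq_continuous_within)
  from continuous_attains_sup[OF _ _ this] h(1)
  obtain s where s: "s \<in> {-h..h}" "\<And>t. t \<in> {-h..h} \<Longrightarrow> norm (?d t) \<le> norm (?d s)" by force
  have "norm (?d s - ?d 0) \<le> (L * norm (?d s)) * \<bar>s - 0\<bar>"
  proof (rule vector_derivative_bound[OF d])
    fix t assume t: "t \<in> {-h..h}"
    have "norm (X (x t) - X (y t)) \<le> L * norm (?d t)" using t x[of t] y[of t] by (intro Lip) auto
    also have "\<dots> \<le> L * norm (?d s)" using s(2)[OF t] h by simp
    finally show "norm (X (x t) - X (y t)) \<le> L * norm (?d s)" .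
  qed (use s h in auto)
  also have "\<dots> \<le> (L * norm (?d s)) * h" using s h by (intro mult_left_mono) auto
  finally have "norm (?d s) \<le> (L * h) * norm (?d s)" using eq by (simp add: mult_ac)
  then have "(1 - L * h) * norm (?d s) \<le> 0" by (simp add: left_diff_distrib)
  then have "norm (?d s) \<le> 0" using h(2) by (simp add: mult_le_0_iff)
  with s(2)[of t] t show ?thesis by (simp add: abs_le_iff)
qed

text \<open>Picard iteration on the Banach space of bounded continuous functions.  The field is composed
  with the nearest-point projection onto a ball, which makes it bounded and Lipschitz everywhere,
  so that the Picard operator is defined on the whole space.  For a short time the solution stays
  in the ball, where the modified and the original field agree.\<close>

lemma ode_exists:
  fixes X :: "'a::euclidean_space \<Rightarrow> 'a"
  assumes "open S" "Ck_on 1 S X" "x0 \<in> S"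
  obtains x h where "h > 0" "x 0 = x0"
    "\<And>t. \<bar>t\<bar> < h \<Longrightarrow> x t \<in> S \<and> (x has_vector_derivative X (x t)) (at t)"
proof -
  obtain \<rho> L where \<rho>: "\<rho> > 0" "L > 0" "cball x0 \<rho> \<subseteq> S"
    and Lip: "\<And>x y. x \<in> cball x0 \<rho> \<Longrightarrow> y \<in> cball x0 \<rho> \<Longrightarrow> norm (X x - X y) \<le> L * norm (x - y)"
    using C1_locally_Lipschitz[OF assms] by metis
  let ?K = "cball x0 \<rho>"
  define Y where "Y y = X (closest_point ?K y)" for y
  have K: "closest_point ?K y \<in> ?K" for y using \<rho>(1) by (intro closest_point_in_set) auto
  have LipY: "norm (Y y - Y z) \<le> L * norm (y - z)" for y z
  proof -
    have "norm (Y y - Y z) \<le> L * norm (closest_point ?K y - closest_point ?K z)"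
      unfolding Y_def by (intro Lip K)
    also have "\<dots> \<le> L * norm (y - z)"
      using closest_point_lipschitz[of ?K y z] \<rho> by (intro mult_left_mono) (auto simp: dist_norm)
    finally show ?thesis .
  qed
  have contY: "continuous_on T (\<lambda>t. Y (f t))" if "continuous_on T f" for T and f :: "real \<Rightarrow> 'a"
  proof -
    have "continuous_on ?K X"
      using continuous_on_subset[OF Ck_on_continuous[OF assms(2)] \<rho>(3)] .
    moreover have "continuous_on T (\<lambda>t. closest_point ?K (f t))"
      using \<rho>(1) that by (auto intro!: continuous_on_compose2[OF continuous_on_closest_point[of ?K UNIV] that])
    ultimately show ?thesis unfolding Y_def by (rule continuous_on_compose2) (use K in blast)
  qed
  have "bounded (X ` ?K)"
    using continuous_on_subset[OF Ck_on_continuous[OF assms(2)] \<rho>(3)]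
    by (intro compact_imp_bounded compact_continuous_image) auto
  then obtain B where B: "B > 0" "\<And>y. norm (Y y) \<le> B"
    unfolding Y_def bounded_pos using K by blast
  \<comment> \<open>\<open>B * h \<le> \<rho>\<close> confines the solution to the ball.  \<open>3 * h * L < 1\<close> makes the Picard operator
    contracting: it contains integrals over intervals of lengths at most \<open>2 * h\<close> and \<open>h\<close>.\<close>
  define h where "h = min (\<rho> / B) (1 / (4 * L))"
  have h: "h > 0" "B * h \<le> \<rho>" "3 * h * L < 1"
    using \<rho> B(1) by (auto simp: h_def min_def field_simps)
  \<comment> \<open>Integrating from \<open>- h\<close> and subtracting treats positive and negative times alike; clamping \<open>t\<close>
    to \<open>[- h, h]\<close> makes the result a bounded function on the whole line.\<close>
  define P where "P y t = x0 + integral {-h..max (-h) (min h t)} (\<lambda>s. Y (y s))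
      - integral {-h..0} (\<lambda>s. Y (y s))" for y :: "real \<Rightarrow> 'a" and t
  have intb: "norm (integral {a..b} f) \<le> C * (b - a)"
    if "continuous_on UNIV f" "\<And>s. norm (f s) \<le> C" "a \<le> b" for f :: "real \<Rightarrow> 'a" and a b C
    using that by (intro integral_bound) (auto intro: continuous_on_subset)
  have PC: "P y \<in> bcontfun" if "continuous_on UNIV y" for y
  proof (rule bcontfun_normI)
    note Yc = contY[OF that]
    have c1: "continuous_on {-h..h} (\<lambda>u. integral {-h..u} (\<lambda>s. Y (y s)))"
      by (intro indefinite_integral_continuous_1 integrable_continuous_real continuous_on_subset[OF Yc]) simp
    show "continuous_on UNIV (P y)"
      unfolding P_def using h(1)
      by (intro continuous_on_diff continuous_on_add continuous_on_const continuous_on_compose2[OF c1]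
          continuous_on_max continuous_on_min continuous_on_id) auto
    show "norm (P y t) \<le> norm x0 + B * (2 * h) + B * h" for t
    proof -
      have "norm (integral {-h..max (-h) (min h t)} (\<lambda>s. Y (y s))) \<le> B * (max (-h) (min h t) - (-h))"
        by (rule intb[OF Yc B(2)]) simp
      also have "\<dots> \<le> B * (2 * h)" using B(1) h(1) by (intro mult_left_mono) auto
      finally have 1: "norm (integral {-h..max (-h) (min h t)} (\<lambda>s. Y (y s))) \<le> B * (2 * h)" .
      have 2: "norm (integral {-h..0} (\<lambda>s. Y (y s))) \<le> B * h"
        using intb[OF Yc B(2), of "-h" 0] h(1) by simp
      show ?thesis unfolding P_def
        using 1 2 norm_triangle_ineq4[of "x0 + integral {-h..max (-h) (min h t)} (\<lambda>s. Y (y s))" "integral {-h..0} (\<lambda>s. Y (y s))"]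
          norm_triangle_ineq[of x0 "integral {-h..max (-h) (min h t)} (\<lambda>s. Y (y s))"]
        by linarith
    qed
  qed
  define Q where "Q y = Bcontfun (P (apply_bcontfun y))" for y
  have Q: "apply_bcontfun (Q y) = P (apply_bcontfun y)" for y
    unfolding Q_def by (intro Bcontfun_inverse PC) simp
  have "dist (Q y) (Q z) \<le> (3 * h * L) * dist y z" for y z
  proof (rule dist_bound)
    fix t
    let ?f = "\<lambda>s. Y (apply_bcontfun y s) - Y (apply_bcontfun z s)"
    let ?m = "max (-h) (min h t)"
    have yz: "continuous_on T (\<lambda>s. Y (apply_bcontfun y s))" "continuous_on T (\<lambda>s. Y (apply_bcontfun z s))" for T
      by (intro contY; simp)+
    have fc: "continuous_on UNIV ?f" by (intro continuous_on_diff yz)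
    have fb: "norm (?f s) \<le> L * dist y z" for s
    proof -
      have "norm (?f s) \<le> L * norm (apply_bcontfun y s - apply_bcontfun z s)" by (rule LipY)
      also have "\<dots> \<le> L * dist y z" using dist_bounded[of y s z] \<rho>(2) by (simp add: dist_norm)
      finally show ?thesis .
    qed
    have eq: "P (apply_bcontfun y) t - P (apply_bcontfun z) t = integral {-h..?m} ?f - integral {-h..0} ?f"
      unfolding P_def by (simp add: integral_diff integrable_continuous_real yz)
    have "norm (integral {-h..?m} ?f) \<le> (L * dist y z) * (?m - (-h))"
      by (rule intb[OF fc fb]) simp
    also have "\<dots> \<le> (L * dist y z) * (2 * h)" using \<rho>(2) h(1) by (intro mult_left_mono) auto
    finally have 1: "norm (integral {-h..?m} ?f) \<le> (L * dist y z) * (2 * h)" .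
    have 2: "norm (integral {-h..0} ?f) \<le> (L * dist y z) * h"
      using intb[OF fc fb, of "-h" 0] h(1) by simp
    have "norm (P (apply_bcontfun y) t - P (apply_bcontfun z) t) \<le> (L * dist y z) * (2 * h) + (L * dist y z) * h"
      unfolding eq using 1 2 norm_triangle_ineq4[of "integral {-h..?m} ?f" "integral {-h..0} ?f"] by linarith
    then show "dist (apply_bcontfun (Q y) t) (apply_bcontfun (Q z) t) \<le> (3 * h * L) * dist y z"
      by (simp add: Q dist_norm algebra_simps)
  qed
  then have "\<exists>!y. Q y = y"
    using h \<rho>(2) by (intro banach_fix_type[where c="3 * h * L"]) auto
  then obtain y where "Q y = y" by blast
  define x where "x = apply_bcontfun y"
  have x: "x t = P x t" for t using \<open>Q y = y\<close> Q[of y] by (simp add: x_def)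
  have xc: "continuous_on T x" for T by (simp add: x_def)
  have x0: "x 0 = x0" using h(1) by (subst x) (simp add: P_def)
  have dx: "(x has_vector_derivative Y (x t)) (at t within {-h..h})" if t: "t \<in> {-h..h}" for t
  proof -
    have "((\<lambda>u. x0 + integral {-h..u} (\<lambda>s. Y (x s)) - integral {-h..0} (\<lambda>s. Y (x s)))
        has_vector_derivative (0 + Y (x t) - 0)) (at t within {-h..h})"
      by (intro has_vector_derivative_diff has_vector_derivative_add has_vector_derivative_const
          integral_has_vector_derivative contY xc t)
    then have "((\<lambda>u. x0 + integral {-h..u} (\<lambda>s. Y (x s)) - integral {-h..0} (\<lambda>s. Y (x s)))
        has_vector_derivative (Y (x t))) (at t within {-h..h})" by simp
    then show ?thesis
      by (rule has_vector_derivative_transform[OF t, rotated]) (subst x, simp add: P_def)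
  qed
  have inK: "x t \<in> ?K" if "t \<in> {-h..h}" for t
  proof -
    have "norm (x t - x 0) \<le> B * \<bar>t - 0\<bar>"
      by (rule vector_derivative_bound[OF dx B(2)]) (use that h in auto)
    also have "\<dots> \<le> B * h" using that B(1) by (intro mult_left_mono) auto
    finally show ?thesis using h(2) x0 by (simp add: dist_norm norm_minus_commute)
  qed
  show thesis
  proof (rule that[of h x], rule h(1), rule x0, intro conjI)
    fix t assume t: "\<bar>t\<bar> < h"
    then have "t \<in> {-h..h}" by auto
    then show "x t \<in> S" using inK[of t] \<rho>(3) by blast
    have "Y (x t) = X (x t)"
      using inK[OF \<open>t \<in> {-h..h}\<close>] by (simp only: Y_def closest_point_self)
    then show "(x has_vector_derivative X (x t)) (at t)"
      using dx[OF \<open>t \<in> {-h..h}\<close>] t by (simp add: at_within_Icc_at abs_less_iff)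
  qed
qed

lemma ode_solution_Ck:
  fixes X :: "'a::euclidean_space \<Rightarrow> 'a"
  assumes "open I" "open S" "\<And>t. t \<in> I \<Longrightarrow> x t \<in> S \<and> (x has_vector_derivative X (x t)) (at t)" "Ck_on k S X"
  shows "Ck_on (Suc k) I x"
  using assms(4)
proof (induction k)
  case 0
  have c: "continuous_on I x"
    using assms(3) by (auto intro!: continuous_at_imp_continuous_on has_vector_derivative_continuous)
  show ?case
    by (rule Ck_on_one_real[OF assms(1)]) (use assms(3) 0 in \<open>auto intro!: continuous_on_compose2[OF _ c]\<close>)
next
  case (Suc k)
  then have x: "Ck_on (Suc k) I x" by (blast intro: Ck_on_Suc_imp)
  have "Ck_on (Suc k) I (\<lambda>t. X (x t))"
    by (rule Ck_on_compose[OF assms(1,2) _ Suc.prems x]) (use assms(3) in blast)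
  then show ?case
    by (rule Ck_on_one_real[OF assms(1), rotated]) (use assms(3) in blast)
qed

section \<open>Additive maps from the real line to a group\<close>

definition multiple :: "nat \<Rightarrow> 'g::group_add \<Rightarrow> 'g" where
  "multiple n g = ((+) g ^^ n) 0"

lemma multiple_simps [simp]: "multiple 0 g = 0" "multiple (Suc n) g = g + multiple n g"
  by (simp_all add: multiple_def)

lemma multiple_add: "multiple (m + n) g = multiple m g + multiple n g"
  by (induction m) (simp_all add: add.assoc)

lemma multiple_mult: "multiple (m * n) g = multiple m (multiple n g)"
  by (induction m) (simp_all add: multiple_add)

lemma multiple_add_commuting:
  assumes "a + b = b + a"
  shows "multiple n (a + b) = multiple n a + multiple n b"
proof -
  have "b + multiple n a = multiple n a + b" for n
    by (induction n) (simp_all, metis add.assoc assms)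
  then show ?thesis by (induction n) (simp_all, metis add.assoc)
qed

lemma additive_on_reals_multiple:
  fixes g :: "real \<Rightarrow> 'g::group_add"
  assumes add: "\<And>s t. \<bar>s\<bar> \<le> \<epsilon> \<Longrightarrow> \<bar>t\<bar> \<le> \<epsilon> \<Longrightarrow> \<bar>s + t\<bar> \<le> \<epsilon> \<Longrightarrow> g (s + t) = g s + g t"
    and "\<bar>real n * t\<bar> \<le> \<epsilon>"
  shows "g (real n * t) = multiple n (g t)"
  using assms(2)
proof (induction n)
  case 0
  then have "g (0 + 0) = g 0 + g 0" by (intro add) auto
  then have "g 0 + g 0 = g 0 + 0" by simp
  then have "g 0 = 0" by (simp only: add_left_cancel)
  then show ?case by simp
next
  case (Suc n)
  have "\<bar>real n * t\<bar> \<le> \<bar>real (Suc n) * t\<bar>" "\<bar>t\<bar> \<le> \<bar>real (Suc n) * t\<bar>"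
    by (auto simp: abs_mult mult_right_mono mult_le_cancel_right1)
  then show ?case using Suc add[of t "real n * t"] by (simp add: distrib_right)
qed

text \<open>The extension is \<open>\<gamma> t = n (g (t / n))\<close> for any large \<open>n\<close>.  It is additive, although the
  group need not commute, because values of \<open>g\<close> at small times commute with each other.\<close>

lemma local_hom_extends:
  fixes g :: "real \<Rightarrow> 'g::group_add"
  assumes \<epsilon>: "\<epsilon> > 0"
    and add: "\<And>s t. \<bar>s\<bar> \<le> \<epsilon> \<Longrightarrow> \<bar>t\<bar> \<le> \<epsilon> \<Longrightarrow> \<bar>s + t\<bar> \<le> \<epsilon> \<Longrightarrow> g (s + t) = g s + g t"
  obtains \<gamma> where "\<And>s t. \<gamma> (s + t) = \<gamma> s + \<gamma> t" "\<And>t. \<bar>t\<bar> \<le> \<epsilon> \<Longrightarrow> \<gamma> t = g t"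
proof -
  define q where "q n t = multiple n (g (t / real n))" for n t
  have q_mult: "q n t = q (n * m) t" if "n > 0" "m > 0" "\<bar>t\<bar> \<le> \<epsilon> * real n" for n m t
  proof -
    have "g (real m * (t / (real n * real m))) = multiple m (g (t / (real n * real m)))"
      by (rule additive_on_reals_multiple[OF add]) (use that in \<open>auto simp: field_simps\<close>)
    then show ?thesis using that by (simp add: q_def multiple_mult)
  qed
  have q_eq: "q n t = q m t" if "n > 0" "m > 0" "\<bar>t\<bar> \<le> \<epsilon> * real n" "\<bar>t\<bar> \<le> \<epsilon> * real m" for n m t
    using q_mult[of n m t] q_mult[of m n t] that by (simp add: mult.commute)
  define N where "N t = Suc (nat \<lceil>\<bar>t\<bar> / \<epsilon>\<rceil>)" for t
  have N: "\<bar>t\<bar> \<le> \<epsilon> * real n" if "n \<ge> N t" for n t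
  proof -
    have "\<bar>t\<bar> / \<epsilon> \<le> real n" using that by (simp add: N_def) linarith
    then show ?thesis using \<epsilon> by (simp add: field_simps)
  qed
  define \<gamma> where "\<gamma> t = q (N t) t" for t
  have \<gamma>: "\<gamma> t = q n t" if "n > 0" "\<bar>t\<bar> \<le> \<epsilon> * real n" for n t
    unfolding \<gamma>_def by (rule q_eq) (use that N[OF order_refl] in \<open>auto simp: N_def\<close>)
  show thesis
  proof (rule that)
    fix s t :: real
    define n where "n = N s + N t + N (s + t)"
    have n: "n > 0" "\<bar>s\<bar> \<le> \<epsilon> * real n" "\<bar>t\<bar> \<le> \<epsilon> * real n" "\<bar>s + t\<bar> \<le> \<epsilon> * real n"
      by (simp add: n_def N_def, (rule N, simp add: n_def)+)
    have "g (s / n + t / n) = g (s / n) + g (t / n)"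
      by (rule add) (use n in \<open>auto simp: field_simps add_divide_distrib[symmetric]\<close>)
    moreover have "g (t / n + s / n) = g (t / n) + g (s / n)"
      by (rule add) (use n in \<open>auto simp: field_simps add_divide_distrib[symmetric]\<close>)
    ultimately have "multiple n (g ((s + t) / n)) = multiple n (g (s / n)) + multiple n (g (t / n))"
      using multiple_add_commuting[of "g (s / n)" "g (t / n)" n]
      by (simp add: add_divide_distrib add.commute[of "t / n"])
    then show "\<gamma> (s + t) = \<gamma> s + \<gamma> t" using n by (simp add: \<gamma> q_def)
  next
    fix t assume "\<bar>t\<bar> \<le> \<epsilon>"
    then show "\<gamma> t = g t" using \<gamma>[of 1 t] by (simp add: q_def)
  qed
qed

lemma hom_eq_if_locally_eq:
  fixes g g' :: "real \<Rightarrow> 'g::group_add"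
  assumes "\<epsilon> > 0" "\<And>s t. g (s + t) = g s + g t" "\<And>s t. g' (s + t) = g' s + g' t"
    and "\<And>t. \<bar>t\<bar> \<le> \<epsilon> \<Longrightarrow> g t = g' t"
  shows "g = g'"
proof
  fix t
  define n where "n = Suc (nat \<lceil>\<bar>t\<bar> / \<epsilon>\<rceil>)"
  have "\<bar>t\<bar> / \<epsilon> \<le> real n" by (simp add: n_def) linarith
  then have "\<bar>t\<bar> \<le> \<epsilon> * real n" using assms(1) by (simp add: field_simps)
  then have "\<bar>t / n\<bar> \<le> \<epsilon>" by (simp add: n_def pos_divide_le_eq del: of_nat_Suc)
  then have "multiple n (g (t / n)) = multiple n (g' (t / n))" using assms(4) by simp
  then have "g (real n * (t / n)) = g' (real n * (t / n))"
    using additive_on_reals_multiple[of "\<bar>real n * (t / n)\<bar>" g n "t / n"]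
      additive_on_reals_multiple[of "\<bar>real n * (t / n)\<bar>" g' n "t / n"] assms(2,3) by simp
  then show "g t = g' t" by (simp add: n_def)
qed

section \<open>One-parameter subgroups\<close>

definition chart_mult :: "'g::group_add set \<Rightarrow> ('g \<Rightarrow> 'e) \<Rightarrow> 'e \<times> 'e \<Rightarrow> 'e" where
  "chart_mult U c = (\<lambda>(x, y). c (inv_into U c x + inv_into U c y))"

definition chart_mult_dom :: "'g::group_add set \<Rightarrow> ('g \<Rightarrow> 'e) \<Rightarrow> ('e \<times> 'e) set" where
  "chart_mult_dom U c = {(x, y) \<in> (c ` U) \<times> (c ` U). inv_into U c x + inv_into U c y \<in> U}"

text \<open>The left-invariant field whose value at the neutral element is \<open>w\<close>, read in the same chart:
  the velocity of \<open>x\<close> multiplied from the right by a curve that leaves the neutral element with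
  velocity \<open>w\<close>.\<close>

definition chart_field :: "'g::group_add set \<Rightarrow> ('g \<Rightarrow> 'e::euclidean_space) \<Rightarrow> 'e \<Rightarrow> 'e \<Rightarrow> 'e" where
  "chart_field U c w x = frechet_derivative (chart_mult U c) (at (x, c 0)) (0, w)"

lemma additive_zero:
  fixes g :: "real \<Rightarrow> 'g::group_add"
  assumes "\<And>s t. g (s + t) = g s + g t"
  shows "g 0 = 0"
proof -
  have "g 0 + g 0 = g 0 + 0" using assms[of 0 0] by simp
  then show ?thesis by (simp only: add_left_cancel)
qed

lemma has_vector_derivative_shift:
  fixes f :: "real \<Rightarrow> 'b::real_normed_vector"
  shows "((\<lambda>h. f (t + h)) has_vector_derivative v) (at s) \<longleftrightarrow> (f has_vector_derivative v) (at (t + s))"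
proof -
  have *: "((\<lambda>h. f (t + h)) has_vector_derivative v) (at s)"
    if "(f has_vector_derivative v) (at (t + s))" for f :: "real \<Rightarrow> 'b::real_normed_vector" and t s
  proof -
    have "((+) t has_vector_derivative 1) (at s)"
      by (auto intro!: derivative_eq_intros simp: has_real_derivative_iff_has_vector_derivative[symmetric])
    from vector_diff_chain_at[OF this that] show ?thesis by (simp add: comp_def)
  qed
  from *[of f t s] *[of "\<lambda>h. f (t + h)" "-t" "t + s"] show ?thesis by auto
qed

context lie_group
begin

context
  fixes U and c :: "'g \<Rightarrow> 'e"
  assumes U: "(U, c) \<in> A" "0 \<in> U"
begin

lemma chart_mult_dom_open: "open (chart_mult_dom U c)"
  unfolding chart_mult_dom_def by (rule chart_product_open[OF U(1) U(1) chart_open[OF U(1)]])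

lemma chart_mult_Ck: "Ck_on k (chart_mult_dom U c) (chart_mult U c)"
  using mult_smooth[OF U(1) U(1) U(1)] unfolding smooth_on_def chart_mult_def chart_mult_dom_def by blast

lemma chart_zero_in_dom: "x \<in> c ` U \<Longrightarrow> (x, c 0) \<in> chart_mult_dom U c"
  using U by (auto simp: chart_mult_dom_def chart_inv)

lemma chart_mult_zero: "x \<in> c ` U \<Longrightarrow> chart_mult U c (x, c 0) = x"
  using U by (auto simp: chart_mult_def chart_inv)

lemma chart_mult_has_derivative_right:
  assumes "(a, b) \<in> chart_mult_dom U c"
  shows "((\<lambda>y. chart_mult U c (a, y)) has_derivative
           (\<lambda>v. frechet_derivative (chart_mult U c) (at (a, b)) (0, v))) (at b)"
proof (rule has_derivative_compose[where f="\<lambda>y. (a, y)"])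
  show "((\<lambda>y. (a, y)) has_derivative (\<lambda>v. (0, v))) (at b)"
    by (auto intro!: derivative_eq_intros)
  show "(chart_mult U c has_derivative frechet_derivative (chart_mult U c) (at (a, b))) (at (a, b))"
    by (rule Ck_on_has_derivative[OF chart_mult_Ck assms])
qed

lemma chart_field_Ck: "Ck_on k (c ` U) (chart_field U c w)"
proof -
  have "Ck_on k (chart_mult_dom U c) (\<lambda>z. frechet_derivative (chart_mult U c) (at z) (0, w))"
    using chart_mult_Ck[of "Suc k"] by simp
  moreover have "Ck_on k (c ` U) (\<lambda>x. (x, c 0))"
    by (intro Ck_on_Pair Ck_on_const Ck_on_bounded_linear_fun bounded_linear_ident chart_image_open[OF U(1)])
  ultimately show ?thesis
    unfolding chart_field_def[abs_def] using chart_zero_in_dom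
    by (intro Ck_on_compose[OF chart_image_open[OF U(1)] chart_mult_dom_open,
          where g="\<lambda>z. frechet_derivative (chart_mult U c) (at z) (0, w)"])
qed

lemma left_translate_velocity:
  assumes g: "g \<in> U" and \<zeta>: "open I" "0 \<in> I" "\<And>h. h \<in> I \<Longrightarrow> \<zeta> h \<in> U" "\<zeta> 0 = 0"
    and w: "((\<lambda>h. c (\<zeta> h)) has_vector_derivative w) (at 0)"
  shows "((\<lambda>h. c (g + \<zeta> h)) has_vector_derivative chart_field U c w (c g)) (at 0)"
proof -
  have "((\<lambda>y. chart_mult U c (c g, y)) has_derivative
      (\<lambda>v. frechet_derivative (chart_mult U c) (at (c g, c 0)) (0, v))) (at (c (\<zeta> 0)))"
    using chart_mult_has_derivative_right[OF chart_zero_in_dom] g \<zeta>(4) by simp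
  from vector_derivative_diff_chain_within[OF w has_derivative_at_withinI[OF this]]
  have "((\<lambda>h. chart_mult U c (c g, c (\<zeta> h))) has_vector_derivative chart_field U c w (c g)) (at 0)"
    by (simp add: comp_def chart_field_def)
  then show ?thesis
    by (rule has_vector_derivative_transform_within_open[OF _ \<zeta>(1,2)])
      (use \<zeta>(3) g in \<open>auto simp: chart_mult_def chart_inv[OF U(1)]\<close>)
qed

text \<open>Left invariance of the field.  By associativity, the curve \<open>a b \<zeta>(h)\<close> can be read as \<open>a\<close> times
  \<open>b \<zeta>(h)\<close> or as \<open>a b\<close> times \<open>\<zeta>(h)\<close>; the two sides are the resulting expressions for its
  velocity.\<close>

lemma chart_field_equivariant:
  assumes ab: "(a, b) \<in> chart_mult_dom U c"
  shows "frechet_derivative (chart_mult U c) (at (a, b)) (0, chart_field U c w b)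
       = chart_field U c w (chart_mult U c (a, b))"
proof -
  define l where "l = (\<lambda>h. c 0 + h *\<^sub>R w)"
  define \<zeta> where "\<zeta> h = inv_into U c (l h)" for h
  let ?p = "inv_into U c a" and ?q = "inv_into U c b"
  have pq: "?p \<in> U" "?q \<in> U" "?p + ?q \<in> U" "c ?p = a" "c ?q = b" "a \<in> c ` U" "b \<in> c ` U"
    using ab by (auto simp: chart_mult_dom_def inv_into_into chart_right_inv)
  have cont: "continuous_on UNIV l" unfolding l_def by (intro continuous_intros)
  have I: "open (l -` (c ` U))" "0 \<in> l -` (c ` U)"
    using continuous_open_preimage[OF cont open_UNIV chart_image_open[OF U(1)]] U(2) by (auto simp: l_def)
  have l: "(l has_vector_derivative w) (at 0)"
    unfolding l_def by (auto intro!: derivative_eq_intros)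
  have w: "((\<lambda>h. c (\<zeta> h)) has_vector_derivative w) (at 0)"
    by (rule has_vector_derivative_transform_within_open[OF l I]) (auto simp: \<zeta>_def chart_right_inv)
  have \<zeta>: "\<And>h. h \<in> l -` (c ` U) \<Longrightarrow> \<zeta> h \<in> U" "\<zeta> 0 = 0"
    using U by (auto simp: \<zeta>_def l_def inv_into_into chart_inv)
  from left_translate_velocity[OF pq(3) I \<zeta> w]
  have 1: "((\<lambda>h. c (?p + ?q + \<zeta> h)) has_vector_derivative chart_field U c w (chart_mult U c (a, b))) (at 0)"
    by (simp add: chart_mult_def)
  have d2: "((\<lambda>h. c (?q + \<zeta> h)) has_vector_derivative chart_field U c w b) (at 0)"
    using left_translate_velocity[OF pq(2) I \<zeta> w] pq by simp
  have "((\<lambda>y. chart_mult U c (a, y)) has_derivative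
      (\<lambda>v. frechet_derivative (chart_mult U c) (at (a, b)) (0, v))) (at (c (?q + \<zeta> 0)))"
    using chart_mult_has_derivative_right[OF ab] \<zeta>(2) pq by simp
  from vector_derivative_diff_chain_within[OF d2 has_derivative_at_withinI[OF this]]
  have "((\<lambda>h. chart_mult U c (a, c (?q + \<zeta> h))) has_vector_derivative
      frechet_derivative (chart_mult U c) (at (a, b)) (0, chart_field U c w b)) (at 0)"
    by (simp add: comp_def)
  moreover
  have "continuous_on (l -` (c ` U)) (\<lambda>h. ?q + \<zeta> h)"
    unfolding \<zeta>_def
    by (intro continuous_on_add continuous_on_const continuous_on_compose2[OF chart_inv_continuous[OF U(1)]]
        continuous_on_subset[OF cont]) auto
  from continuous_open_preimage[OF this I(1) chart_open[OF U(1)]]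
  have "open (l -` (c ` U) \<inter> (\<lambda>h. ?q + \<zeta> h) -` U)" .
  ultimately have "((\<lambda>h. c (?p + ?q + \<zeta> h)) has_vector_derivative
      frechet_derivative (chart_mult U c) (at (a, b)) (0, chart_field U c w b)) (at 0)"
    by (rule has_vector_derivative_transform_within_open)
      (use I(2) \<zeta>(2) pq in \<open>auto simp: chart_mult_def chart_inv[OF U(1)] add.assoc\<close>)
  from vector_derivative_unique_at[OF this 1] show ?thesis .
qed

text \<open>Let \<open>x\<close> solve the equation of the field with \<open>x 0\<close> the neutral element.  For fixed \<open>s\<close> both
  \<open>x (s + t)\<close> and the product of \<open>x s\<close> and \<open>x t\<close> are solutions in \<open>t\<close>, the latter by left
  invariance, and they agree at \<open>t = 0\<close>.  Uniqueness makes \<open>x\<close> additive.\<close>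

lemma local_one_parameter_group:
  obtains g :: "real \<Rightarrow> 'g" and \<epsilon> where "\<epsilon> > 0" "\<And>t. \<bar>t\<bar> < \<epsilon> \<Longrightarrow> g t \<in> U"
    "continuous_on {-\<epsilon><..<\<epsilon>} g" "((\<lambda>t. c (g t)) has_vector_derivative w) (at 0)"
    "\<And>s t. \<bar>s\<bar> \<le> \<epsilon> / 2 \<Longrightarrow> \<bar>t\<bar> \<le> \<epsilon> / 2 \<Longrightarrow> g (s + t) = g s + g t"
proof -
  let ?X = "chart_field U c w" and ?x0 = "c 0" and ?M = "chart_mult_dom U c" and ?\<mu> = "chart_mult U c"
  have x0: "?x0 \<in> c ` U" using U by blast
  have op: "open (c ` U)" by (rule chart_image_open[OF U(1)])
  obtain x h where h: "h > 0" and x0': "x 0 = ?x0"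
    and x: "\<And>t. \<bar>t\<bar> < h \<Longrightarrow> x t \<in> c ` U \<and> (x has_vector_derivative ?X (x t)) (at t)"
    using ode_exists[OF op chart_field_Ck x0] by metis
  obtain \<rho> L where \<rho>: "\<rho> > 0" "L > 0"
    and Lip: "\<And>x y. x \<in> cball ?x0 \<rho> \<Longrightarrow> y \<in> cball ?x0 \<rho> \<Longrightarrow> norm (?X x - ?X y) \<le> L * norm (x - y)"
    using C1_locally_Lipschitz[OF op chart_field_Ck x0] by metis
  have xc: "continuous_on {-h<..<h} x"
    by (intro continuous_at_imp_continuous_on ballI has_vector_derivative_continuous[OF conjunct2[OF x]]) auto
  \<comment> \<open>\<open>O1\<close> and \<open>O2\<close> collect the pairs of times for which both solutions are defined and stay in the
    ball on which the field is Lipschitz.\<close>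
  define Z where "Z = {-h/2<..<h/2} \<times> {-h/2<..<h/2}"
  have Z: "open Z" "(0, 0) \<in> Z" using h by (auto simp: Z_def open_Times)
  define O1 where "O1 = Z \<inter> (\<lambda>z. (x (fst z), x (snd z))) -` (?M \<inter> ?\<mu> -` ball ?x0 \<rho>)"
  define O2 where "O2 = Z \<inter> (\<lambda>z. x (fst z + snd z)) -` ball ?x0 \<rho>"
  have "open (?M \<inter> ?\<mu> -` ball ?x0 \<rho>)"
    by (rule continuous_open_preimage[OF Ck_on_continuous[OF chart_mult_Ck] chart_mult_dom_open open_ball])
  then have "open O1" unfolding O1_def
    by (intro continuous_open_preimage[OF _ Z(1)] continuous_on_Pair continuous_on_compose2[OF xc]
         continuous_on_fst continuous_on_snd continuous_on_id) (use h in \<open>auto simp: Z_def\<close>)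
  moreover have "open O2" unfolding O2_def
    by (intro continuous_open_preimage[OF _ Z(1)] continuous_on_compose2[OF xc] continuous_on_add
         continuous_on_fst continuous_on_snd continuous_on_id) (use h in \<open>auto simp: Z_def\<close>)
  moreover have "(0, 0) \<in> O1 \<inter> O2"
    using Z(2) x0' \<rho>(1) chart_zero_in_dom[OF x0] chart_mult_zero[OF x0] by (simp add: O1_def O2_def)
  ultimately obtain e where e: "e > 0" "ball (0, 0) e \<subseteq> O1 \<inter> O2"
    by (meson open_Int open_contains_ball)
  define \<epsilon> where "\<epsilon> = min (e / 3) (1 / (2 * L))"
  have \<epsilon>: "\<epsilon> > 0" "L * \<epsilon> < 1" using e(1) \<rho> by (auto simp: \<epsilon>_def min_def field_simps)
  have O: "(s, t) \<in> O1 \<inter> O2" if "\<bar>s\<bar> \<le> \<epsilon>" "\<bar>t\<bar> \<le> \<epsilon>" for s t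
  proof -
    have "norm (s, t) \<le> \<bar>s\<bar> + \<bar>t\<bar>" using norm_Pair_le[of s t] by simp
    also have "\<dots> < e" using that e(1) by (simp add: \<epsilon>_def)
    finally have "dist (0, 0) (s, t) < e" by (simp add: dist_Pair_Pair norm_Pair)
    then have "(s, t) \<in> ball (0, 0) e" by simp
    then show ?thesis using e(2) by blast
  qed
  have small: "\<bar>s\<bar> < h / 2" if "\<bar>s\<bar> \<le> \<epsilon>" for s
    using O[OF that that] by (auto simp: O1_def Z_def)
  have hom: "x (s + t) = ?\<mu> (x s, x t)" if st: "\<bar>s\<bar> \<le> \<epsilon>" "\<bar>t\<bar> \<le> \<epsilon>" for s t
  proof (rule ode_unique[OF Lip \<epsilon> \<rho>(2) _ _ _ st(2)])
    fix r assume r: "\<bar>r\<bar> \<le> \<epsilon>"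
    have "\<bar>s + r\<bar> < h" using small[OF r] small[OF st(1)] by linarith
    then have "((\<lambda>r. x (s + r)) has_vector_derivative ?X (x (s + r))) (at r)"
      unfolding has_vector_derivative_shift using x by blast
    then show "x (s + r) \<in> cball ?x0 \<rho> \<and> ((\<lambda>r. x (s + r)) has_vector_derivative ?X (x (s + r))) (at r)"
      using O[OF st(1) r] by (auto simp: O2_def)
    have dom: "(x s, x r) \<in> ?M" using O[OF st(1) r] by (auto simp: O1_def)
    have "(x has_vector_derivative ?X (x r)) (at r)" using small[OF r] h x[of r] by linarith
    from vector_derivative_diff_chain_within[OF this has_derivative_at_withinI[OF chart_mult_has_derivative_right[OF dom]]]
    have "((\<lambda>r. ?\<mu> (x s, x r)) has_vector_derivative ?X (?\<mu> (x s, x r))) (at r)"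
      by (simp add: comp_def chart_field_equivariant[OF dom])
    then show "?\<mu> (x s, x r) \<in> cball ?x0 \<rho> \<and>
        ((\<lambda>r. ?\<mu> (x s, x r)) has_vector_derivative ?X (?\<mu> (x s, x r))) (at r)"
      using O[OF st(1) r] by (auto simp: O1_def)
  next
    show "x (s + 0) = ?\<mu> (x s, x 0)"
      using x0' chart_mult_zero[of "x s"] x[of s] small[OF st(1)] h by simp
  qed
  define g where "g t = inv_into U c (x t)" for t
  have xU: "x t \<in> c ` U" if "\<bar>t\<bar> \<le> \<epsilon>" for t using x[of t] small[OF that] h by simp
  show thesis
  proof (rule that[of \<epsilon> g])
    show "\<epsilon> > 0" by (rule \<epsilon>)
    show "g t \<in> U" if "\<bar>t\<bar> < \<epsilon>" for t using xU[of t] that by (simp add: g_def inv_into_into)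
    show "continuous_on {-\<epsilon><..<\<epsilon>} g" unfolding g_def
      by (rule continuous_on_compose2[OF chart_inv_continuous[OF U(1)] continuous_on_subset[OF xc]])
        (use xU small[of \<epsilon>] \<epsilon> h in force)+
    have "?X ?x0 = w"
    proof -
      have eq: "frechet_derivative ?\<mu> (at (?x0, ?x0)) (0, w) = w"
      proof -
        have "((\<lambda>y. ?\<mu> (?x0, y)) has_derivative (\<lambda>v. v)) (at ?x0)"
          by (rule has_derivative_transform_within_open[OF has_derivative_ident op x0])
            (use U in \<open>auto simp: chart_mult_def chart_inv chart_right_inv\<close>)
        from has_derivative_unique[OF this chart_mult_has_derivative_right[OF chart_zero_in_dom[OF x0]]]
        show ?thesis by metis
      qed
      then show ?thesis by (simp add: chart_field_def)
    qed
    then have "(x has_vector_derivative w) (at 0)" using x[of 0] h x0' by simp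
    then show "((\<lambda>t. c (g t)) has_vector_derivative w) (at 0)"
      by (rule has_vector_derivative_transform_within_open[where S="{-\<epsilon><..<\<epsilon>}"])
        (use xU \<epsilon> in \<open>auto simp: g_def chart_right_inv\<close>)
    show "g (s + t) = g s + g t" if "\<bar>s\<bar> \<le> \<epsilon> / 2" "\<bar>t\<bar> \<le> \<epsilon> / 2" for s t
    proof -
      have "\<bar>s\<bar> \<le> \<epsilon>" "\<bar>t\<bar> \<le> \<epsilon>" using that by auto
      with O[of s t] hom[of s t] show ?thesis
        by (auto simp: g_def chart_mult_def O1_def chart_mult_dom_def chart_inv[OF U(1)])
    qed
  qed
qed

lemma hom_satisfies_ode:
  assumes \<gamma>: "continuous_on UNIV \<gamma>" "\<And>s t. \<gamma> (s + t) = \<gamma> s + \<gamma> t"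
    and w: "((\<lambda>t. c (\<gamma> t)) has_vector_derivative w) (at 0)" and t: "\<gamma> t \<in> U"
  shows "((\<lambda>t. c (\<gamma> t)) has_vector_derivative chart_field U c w (c (\<gamma> t))) (at t)"
proof -
  have 0: "\<gamma> 0 = 0" using \<gamma>(2) by (rule additive_zero)
  have "open (\<gamma> -` U)" using continuous_open_preimage[OF \<gamma>(1) open_UNIV chart_open[OF U(1)]] by simp
  from left_translate_velocity[OF t this _ _ 0 w] 0 U(2)
  have "((\<lambda>h. c (\<gamma> (t + h))) has_vector_derivative chart_field U c w (c (\<gamma> t))) (at 0)"
    by (simp add: \<gamma>(2))
  then show ?thesis using has_vector_derivative_shift[of "\<lambda>t. c (\<gamma> t)" t _ 0] by simp
qed

text \<open>Near time 0 the curve solves the equation of a smooth field and is therefore smooth;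
  translations carry this to all other times.\<close>

lemma hom_Ck_into:
  assumes \<gamma>: "continuous_on UNIV \<gamma>" "\<And>s t. \<gamma> (s + t) = \<gamma> s + \<gamma> t"
    and w: "((\<lambda>t. c (\<gamma> t)) has_vector_derivative w) (at 0)"
  shows "Ck_into A k UNIV \<gamma>"
proof (rule Ck_into_local)
  fix t0 :: real
  have 0: "\<gamma> 0 = 0" using \<gamma>(2) by (rule additive_zero)
  have I: "open (\<gamma> -` U)" using continuous_open_preimage[OF \<gamma>(1) open_UNIV chart_open[OF U(1)]] by simp
  have "Ck_on (Suc k) (\<gamma> -` U) (\<lambda>t. c (\<gamma> t))"
    by (rule ode_solution_Ck[OF I chart_image_open[OF U(1)] _ chart_field_Ck])
      (use hom_satisfies_ode[OF \<gamma> w] in auto)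
  then have "Ck_on k (\<gamma> -` U) (\<lambda>t. c (\<gamma> t))" by (rule Ck_on_Suc_imp)
  then have loc: "Ck_into A k (\<gamma> -` U) \<gamma>"
    by (intro Ck_into_local bexI[OF _ U(1)]) (auto intro!: exI[of _ "\<gamma> -` U"] I)
  let ?S = "(\<lambda>t. t - t0) -` (\<gamma> -` U)"
  have S: "open ?S"
    by (rule open_vimage[OF I]) (intro continuous_intros)
  have "Ck_into A k ?S (\<lambda>t. \<gamma> t0 + \<gamma> (t - t0))"
    by (intro Ck_into_add[OF S] Ck_into_const Ck_into_compose[OF I S _ loc] Ck_on_diff Ck_on_const
        Ck_on_bounded_linear_fun bounded_linear_ident S) simp
  then have sm: "Ck_into A k ?S \<gamma>" using \<gamma>(2)[of t0] by (simp flip: \<gamma>(2))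
  obtain V d where V: "(V, d) \<in> A" "\<gamma> t0 \<in> V" by (rule chart_at)
  have "open {t\<in>?S. \<gamma> t \<in> V}" by (rule Ck_into_preimage_open[OF sm S chart_open[OF V(1)]])
  moreover have "t0 \<in> {t\<in>?S. \<gamma> t \<in> V}" using 0 U(2) V(2) by simp
  ultimately show "\<exists>(V, d)\<in>A. \<exists>T. open T \<and> t0 \<in> T \<and> \<gamma> ` T \<subseteq> V \<and> Ck_on k T (\<lambda>t. d (\<gamma> t))"
    using Ck_into_chart[OF sm V(1)] by (intro bexI[OF _ V(1)]) (auto intro!: exI[of _ "{t\<in>?S. \<gamma> t \<in> V}"])
qed

lemma hom_unique:
  assumes \<gamma>: "continuous_on UNIV \<gamma>" "\<And>s t. \<gamma> (s + t) = \<gamma> s + \<gamma> t"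
    and w: "((\<lambda>t. c (\<gamma> t)) has_vector_derivative w) (at 0)"
    and \<gamma>': "continuous_on UNIV \<gamma>'" "\<And>s t. \<gamma>' (s + t) = \<gamma>' s + \<gamma>' t"
    and w': "((\<lambda>t. c (\<gamma>' t)) has_vector_derivative w) (at 0)"
  shows "\<gamma> = \<gamma>'"
proof -
  have 0: "\<gamma> 0 = 0" "\<gamma>' 0 = 0" using additive_zero[of \<gamma>, OF \<gamma>(2)] additive_zero[of \<gamma>', OF \<gamma>'(2)] by simp_all
  have x0: "c 0 \<in> c ` U" using U by blast
  obtain \<rho> L where \<rho>: "\<rho> > 0" "L > 0"
    and Lip: "\<And>x y. x \<in> cball (c 0) \<rho> \<Longrightarrow> y \<in> cball (c 0) \<rho> \<Longrightarrow>
        norm (chart_field U c w x - chart_field U c w y) \<le> L * norm (x - y)"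
    using C1_locally_Lipschitz[OF chart_image_open[OF U(1)] chart_field_Ck x0] by metis
  let ?N = "U \<inter> c -` ball (c 0) \<rho>"
  have N: "open ?N"
    by (rule continuous_open_preimage[OF chart_continuous[OF U(1)] chart_open[OF U(1)] open_ball])
  have "open (\<gamma> -` ?N \<inter> \<gamma>' -` ?N)"
    using continuous_open_preimage[OF \<gamma>(1) open_UNIV N] continuous_open_preimage[OF \<gamma>'(1) open_UNIV N]
    by auto
  moreover have "0 \<in> \<gamma> -` ?N \<inter> \<gamma>' -` ?N" using 0 U(2) \<rho>(1) by simp
  ultimately obtain e where e: "e > 0" "cball 0 e \<subseteq> \<gamma> -` ?N \<inter> \<gamma>' -` ?N"
    by (meson open_contains_cball)
  define \<epsilon> where "\<epsilon> = min e (1 / (2 * L))"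
  have \<epsilon>: "\<epsilon> > 0" "L * \<epsilon> < 1" using e(1) \<rho> by (auto simp: \<epsilon>_def min_def field_simps)
  have in_N: "\<gamma> t \<in> ?N" "\<gamma>' t \<in> ?N" if "\<bar>t\<bar> \<le> \<epsilon>" for t
  proof -
    have "t \<in> cball 0 e" using that by (simp add: \<epsilon>_def)
    with e(2) show "\<gamma> t \<in> ?N" "\<gamma>' t \<in> ?N" by blast+
  qed
  have "c (\<gamma> t) = c (\<gamma>' t)" if "\<bar>t\<bar> \<le> \<epsilon>" for t
    by (rule ode_unique[where B="cball (c 0) \<rho>" and x="\<lambda>t. c (\<gamma> t)" and y="\<lambda>t. c (\<gamma>' t)", OF Lip \<epsilon> \<rho>(2) _ _ _ that])
      (use in_N hom_satisfies_ode[OF \<gamma> w] hom_satisfies_ode[OF \<gamma>' w'] 0 in \<open>auto intro: less_imp_le\<close>)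
  then have "\<gamma> t = \<gamma>' t" if "\<bar>t\<bar> \<le> \<epsilon>" for t
    using in_N[OF that] that chart_inv[OF U(1)] by (metis IntD1)
  then show ?thesis by (rule hom_eq_if_locally_eq[OF \<epsilon>(1) \<gamma>(2) \<gamma>'(2)])
qed

text \<open>The derivative of \<open>c (\<gamma> t)\<close> is found by testing \<open>\<gamma>\<close> on the coordinate functions of the chart,
  which are \<open>C\<^sup>1\<close> near the neutral element.\<close>

lemma one_param_subgroup_in_chart:
  assumes \<gamma>: "one_param_subgroup A D v \<gamma>"
    and w: "\<And>f. C1_near A 0 f \<Longrightarrow> D v f = frechet_derivative (\<lambda>y. f (inv_into U c y)) (at (c 0)) w"
  shows "((\<lambda>t. c (\<gamma> t)) has_vector_derivative w) (at 0)"
proof -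
  have "((\<lambda>t. c (\<gamma> t) \<bullet> b) has_derivative (\<lambda>h. (h *\<^sub>R w) \<bullet> b)) (at 0)" for b
  proof -
    have lin: "bounded_linear (\<lambda>y. y \<bullet> b)" by (rule bounded_linear_inner_left)
    have eq: "c (inv_into U c y) \<bullet> b = y \<bullet> b" if "y \<in> c ` U" for y
      using that by (simp add: chart_right_inv)
    have "Ck_on 1 (c ` U) (\<lambda>y. c (inv_into U c y) \<bullet> b)"
      by (rule Ck_on_cong[OF chart_image_open[OF U(1)] _ Ck_on_bounded_linear_fun[OF lin]]) (simp add: eq)
    then have "Ck_fun A 1 U (\<lambda>x. c x \<bullet> b)"
      using U(1) chart_open[OF U(1)] by (intro Ck_funI bexI[OF _ U(1)]) auto
    then have C1: "C1_near A 0 (\<lambda>x. c x \<bullet> b)"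
      unfolding C1_near_def using chart_open[OF U(1)] U(2) by blast
    have "((\<lambda>y. c (inv_into U c y) \<bullet> b) has_derivative (\<lambda>y. y \<bullet> b)) (at (c 0))"
      by (rule has_derivative_transform_within_open[OF bounded_linear_imp_has_derivative[OF lin]
            chart_image_open[OF U(1)]]) (use U(2) eq in auto)
    then have "frechet_derivative (\<lambda>y. c (inv_into U c y) \<bullet> b) (at (c 0)) = (\<lambda>y. y \<bullet> b)"
      by (rule frechet_derivative_at[symmetric])
    then have "D v (\<lambda>x. c x \<bullet> b) = w \<bullet> b" using w[OF C1] by simp
    moreover have "((\<lambda>t. f (\<gamma> t)) has_real_derivative D v f) (at 0)" if "C1_near A 0 f" for f
      using \<gamma> that unfolding one_param_subgroup_def by blast
    from this[OF C1] have "((\<lambda>t. c (\<gamma> t) \<bullet> b) has_real_derivative D v (\<lambda>x. c x \<bullet> b)) (at 0)" .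
    ultimately have "((\<lambda>t. c (\<gamma> t) \<bullet> b) has_real_derivative w \<bullet> b) (at 0)" by simp
    then show ?thesis
      unfolding has_field_derivative_def by (rule has_derivative_eq_rhs) (simp add: fun_eq_iff)
  qed
  then have "((\<lambda>t. c (\<gamma> t)) has_derivative (\<lambda>h. h *\<^sub>R w)) (at 0)"
    by (subst has_derivative_componentwise_within) blast
  then show ?thesis by (simp add: has_vector_derivative_def)
qed

end

lemma lie_algebra_element_in_chart:
  assumes "lie_algebra_iso A D" "(U, c) \<in> A" "0 \<in> U"
  obtains w where "\<And>f. C1_near A 0 f \<Longrightarrow>
    D v f = frechet_derivative (\<lambda>y. f (inv_into U c y)) (at (c 0)) w"
proof -
  have "D v \<in> tangent_space A 0" using assms(1) unfolding lie_algebra_iso_def bij_betw_def by blast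
  from tangent_vector_in_chart[OF this assms(2,3)] that show thesis by metis
qed

lemma one_param_subgroup_exists:
  assumes "lie_algebra_iso A D"
  obtains \<gamma> where "one_param_subgroup A D v \<gamma>"
proof -
  obtain U c where U: "(U, c) \<in> A" "0 \<in> U" by (rule chart_at)
  obtain w where w: "\<And>f. C1_near A 0 f \<Longrightarrow> D v f = frechet_derivative (\<lambda>y. f (inv_into U c y)) (at (c 0)) w"
    using lie_algebra_element_in_chart[OF assms U, of v] by metis
  obtain g :: "real \<Rightarrow> 'g" and \<epsilon> where \<epsilon>: "\<epsilon> > 0" and gU: "\<And>t. \<bar>t\<bar> < \<epsilon> \<Longrightarrow> g t \<in> U"
    and gc: "continuous_on {-\<epsilon><..<\<epsilon>} g" and gw: "((\<lambda>t. c (g t)) has_vector_derivative w) (at 0)"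
    and hom: "\<And>s t. \<bar>s\<bar> \<le> \<epsilon> / 2 \<Longrightarrow> \<bar>t\<bar> \<le> \<epsilon> / 2 \<Longrightarrow> g (s + t) = g s + g t"
    using local_one_parameter_group[OF U] by metis
  have "\<epsilon> / 2 > 0" using \<epsilon> by simp
  then obtain \<gamma> where \<gamma>: "\<And>s t. \<gamma> (s + t) = \<gamma> s + \<gamma> t" "\<And>t. \<bar>t\<bar> \<le> \<epsilon> / 2 \<Longrightarrow> \<gamma> t = g t"
    using local_hom_extends[of "\<epsilon> / 2" g] hom by metis
  have 0: "\<gamma> 0 = 0" using \<gamma>(1) by (rule additive_zero)
  let ?I = "{-\<epsilon>/2<..<\<epsilon>/2}"
  have "continuous_on ?I \<gamma>"
    by (rule continuous_on_eq[OF continuous_on_subset[OF gc]]) (use \<gamma>(2) \<epsilon> in auto)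
  then have c0: "isCont \<gamma> 0" using \<epsilon> by (simp add: continuous_on_eq_continuous_at)
  have "isCont \<gamma> t" for t
  proof -
    have "isCont (\<lambda>s. \<gamma> (s - t)) t"
      by (rule isCont_o2[where f="\<lambda>s. s - t"]) (use c0 in auto)
    then have "isCont (\<lambda>s. \<gamma> t + \<gamma> (s - t)) t" by (intro continuous_intros)
    then show ?thesis by (simp flip: \<gamma>(1))
  qed
  then have cont: "continuous_on UNIV \<gamma>" by (simp add: continuous_at_imp_continuous_on)
  have gw: "((\<lambda>t. c (\<gamma> t)) has_vector_derivative w) (at 0)"
    by (rule has_vector_derivative_transform_within_open[OF gw, of ?I]) (use \<gamma>(2) \<epsilon> in auto)
  have "((\<lambda>t. f (\<gamma> t)) has_real_derivative D v f) (at 0)" if f: "C1_near A 0 f" for f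
    unfolding w[OF f]
    by (rule C1_near_chain_rule[OF f U, of ?I, OF _ _ _ _ gw]) (use \<epsilon> 0 \<gamma>(2) gU in auto)
  then show thesis using cont \<gamma>(1) by (intro that[of \<gamma>]) (simp add: one_param_subgroup_def)
qed

lemma
  assumes D: "lie_algebra_iso A D" and \<gamma>: "one_param_subgroup A D v \<gamma>"
  shows one_param_subgroup_Ck_into: "Ck_into A k UNIV \<gamma>"
    and one_param_subgroup_unique: "one_param_subgroup A D v \<gamma>' \<Longrightarrow> \<gamma>' = \<gamma>"
proof -
  obtain U c where U: "(U, c) \<in> A" "0 \<in> U" by (rule chart_at)
  obtain w where w: "\<And>f. C1_near A 0 f \<Longrightarrow> D v f = frechet_derivative (\<lambda>y. f (inv_into U c y)) (at (c 0)) w"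
    using lie_algebra_element_in_chart[OF D U, of v] by metis
  have W: "((\<lambda>t. c (\<delta> t)) has_vector_derivative w) (at 0)" if "one_param_subgroup A D v \<delta>" for \<delta>
    by (rule one_param_subgroup_in_chart[OF U that w])
  show "Ck_into A k UNIV \<gamma>"
    by (rule hom_Ck_into[OF U _ _ W[OF \<gamma>]]) (use \<gamma> in \<open>auto simp: one_param_subgroup_def\<close>)
  show "\<gamma>' = \<gamma>" if \<gamma>': "one_param_subgroup A D v \<gamma>'"
    by (rule hom_unique[OF U _ _ W[OF \<gamma>'] _ _ W[OF \<gamma>]])
      (use \<gamma> \<gamma>' in \<open>auto simp: one_param_subgroup_def\<close>)
qed

lemma lie_exp_scaleR:
  assumes D: "lie_algebra_iso A D" and \<gamma>: "one_param_subgroup A D v \<gamma>"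
  shows "lie_exp A D (s *\<^sub>R v) = \<gamma> s"
proof -
  have lin: "D (s *\<^sub>R v) f = s * D v f" for f
    using D unfolding lie_algebra_iso_def by (metis (no_types, lifting) add.right_neutral mult_zero_left scaleR_zero_left)
  have "one_param_subgroup A D (s *\<^sub>R v) (\<lambda>t. \<gamma> (s * t))"
    unfolding one_param_subgroup_def
  proof (intro conjI allI impI)
    show "continuous_on UNIV (\<lambda>t. \<gamma> (s * t))"
      using \<gamma> by (auto simp: one_param_subgroup_def intro!: continuous_on_compose2[of UNIV \<gamma>] continuous_intros)
    show "\<gamma> (s * (t + t')) = \<gamma> (s * t) + \<gamma> (s * t')" for t t'
      using \<gamma> by (simp add: one_param_subgroup_def distrib_left)
    fix f :: "'g \<Rightarrow> real" assume "C1_near A 0 f"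
    then have "((\<lambda>t. f (\<gamma> t)) has_real_derivative D v f) (at (s * 0))"
      using \<gamma> by (simp add: one_param_subgroup_def)
    from DERIV_chain2[where g="\<lambda>t. s * t" and f="\<lambda>t. f (\<gamma> t)", OF this, of s]
    have "((\<lambda>t. f (\<gamma> (s * t))) has_real_derivative D v f * s) (at 0)"
      by (auto intro!: derivative_eq_intros)
    then show "((\<lambda>t. f (\<gamma> (s * t))) has_real_derivative D (s *\<^sub>R v) f) (at 0)"
      by (simp add: lin mult.commute[of _ s])
  qed
  from the_equality[of "one_param_subgroup A D (s *\<^sub>R v)", OF this one_param_subgroup_unique[OF D this]]
  show ?thesis unfolding lie_exp_def by simp
qed

end

section \<open>Upper semicontinuous functions on compact sets\<close>

lemma usc_on_compose_diff:
  fixes u :: "'g::topological_space \<Rightarrow> real"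
  assumes u: "usc_on UNIV u" and F: "continuous_on K F" and \<psi>: "continuous_on K \<psi>"
  shows "usc_on K (\<lambda>z. u (F z) - \<psi> z)"
  unfolding usc_on_def
proof (intro ballI allI impI)
  fix p a assume p: "p \<in> K" and a: "a > u (F p) - \<psi> p"
  define \<delta> where "\<delta> = (a - (u (F p) - \<psi> p)) / 2"
  have \<delta>: "\<delta> > 0" using a by (simp add: \<delta>_def)
  have "\<forall>\<^sub>F x in at (F p). u x < u (F p) + \<delta>"
    using u \<delta> unfolding usc_on_def by simp
  then have "\<forall>\<^sub>F x in nhds (F p). u x < u (F p) + \<delta>"
    using \<delta> by (simp add: eventually_nhds_conv_at)
  moreover have "filterlim F (nhds (F p)) (at p within K)"
    using F p by (simp add: continuous_on)
  ultimately have 1: "\<forall>\<^sub>F z in at p within K. u (F z) < u (F p) + \<delta>"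
    by (rule eventually_compose_filterlim)
  have "(\<psi> \<longlongrightarrow> \<psi> p) (at p within K)" using \<psi> p by (simp add: continuous_on)
  then have 2: "\<forall>\<^sub>F z in at p within K. \<psi> p - \<delta> < \<psi> z"
    using \<delta> by (auto simp: order_tendsto_iff)
  have \<delta>2: "2 * \<delta> = a - (u (F p) - \<psi> p)" by (simp add: \<delta>_def)
  show "\<forall>\<^sub>F z in at p within K. u (F z) - \<psi> z < a"
    using 1 2 by eventually_elim (use \<delta>2 in linarith)
qed

lemma usc_on_attains_max:
  assumes f: "usc_on K f" and K: "compact K" "K \<noteq> {}"
  obtains x where "x \<in> K" "\<And>y. y \<in> K \<Longrightarrow> f y \<le> f x"
proof -
  have "\<exists>x\<in>K. \<forall>y\<in>K. f y \<le> f x"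
  proof (rule ccontr)
    assume "\<not> ?thesis"
    then have "\<forall>x\<in>K. \<exists>y\<in>K. f x < f y" by (meson not_le)
    then obtain b where b: "\<And>x. x \<in> K \<Longrightarrow> b x \<in> K \<and> f x < f (b x)" by metis
    have "\<exists>T. open T \<and> x \<in> T \<and> (\<forall>z\<in>T \<inter> K. f z < f (b x))" if x: "x \<in> K" for x
    proof -
      have "\<forall>\<^sub>F z in at x within K. f z < f (b x)" using f b[OF x] x unfolding usc_on_def by blast
      then obtain T where "open T" "x \<in> T" "\<And>z. z \<in> T \<Longrightarrow> z \<noteq> x \<Longrightarrow> z \<in> K \<Longrightarrow> f z < f (b x)"
        by (auto simp: eventually_at_topological)
      then show ?thesis using b[OF x] by (metis IntE)
    qed
    then obtain T where T: "\<And>x. x \<in> K \<Longrightarrow> open (T x) \<and> x \<in> T x \<and> (\<forall>z\<in>T x \<inter> K. f z < f (b x))"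
      by metis
    obtain C where C: "C \<subseteq> K" "finite C" "K \<subseteq> (\<Union>x\<in>C. T x)"
      using compactE_image[OF K(1), of K T] T by blast
    with K(2) have "C \<noteq> {}" by auto
    then have "Max ((\<lambda>x. f (b x)) ` C) \<in> (\<lambda>x. f (b x)) ` C" using C(2) by (intro Max_in) auto
    then obtain x where x: "x \<in> C" "f (b x) = Max ((\<lambda>x. f (b x)) ` C)" by auto
    then have x_max: "f (b y) \<le> f (b x)" if "y \<in> C" for y using that C(2) by simp
    have "b x \<in> K" using b x(1) C(1) by blast
    with C(3) obtain y where y: "y \<in> C" "b x \<in> T y" by blast
    then have "f (b x) < f (b y)" using T[of y] C(1) \<open>b x \<in> K\<close> by blast
    with x_max[OF y(1)] show False by simp
  qed
  with that show thesis by blast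
qed

section \<open>Second derivatives along a reparametrised line\<close>

text \<open>Since \<open>\<theta> s = s + o(s\<^sup>2)\<close>, the function \<open>f\<close> agrees with \<open>q (a + s)\<close> up to a constant and an error
  \<open>o(s\<^sup>2)\<close>: the argument of \<open>G\<close> stands still to second order.\<close>

lemma second_derivative_after_reparametrisation:
  fixes f q G \<theta> :: "real \<Rightarrow> real"
  assumes I: "open I" "0 \<in> I"
    and \<theta>: "\<And>s. s \<in> I \<Longrightarrow> (\<theta> has_real_derivative \<theta>' s) (at s)" "(\<theta>' has_real_derivative 0) (at 0)"
      "\<theta> 0 = 0" "\<theta>' 0 = 1"
    and q: "\<And>t. (q has_real_derivative q' t) (at t)" "(q' has_real_derivative q'') (at a)"
    and G: "\<And>r. r \<in> J \<Longrightarrow> (G has_real_derivative G' r) (at r)" "(G' has_real_derivative G'') (at 0)"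
    and f: "\<And>s. s \<in> I \<Longrightarrow> (f has_real_derivative f' s) (at s)" "(f' has_real_derivative f'') (at 0)"
    and eq: "\<And>s. s \<in> I \<Longrightarrow> s - \<theta> s \<in> J \<and> f s = q (a + \<theta> s) + G (s - \<theta> s)"
  shows "f'' = q''"
proof -
  let ?h = "\<lambda>s. q' (a + \<theta> s) * \<theta>' s + G' (s - \<theta> s) * (1 - \<theta>' s)"
  have "f' s = ?h s" if s: "s \<in> I" for s
  proof -
    have d1: "((\<lambda>s. a + \<theta> s) has_real_derivative \<theta>' s) (at s)"
      using \<theta>(1)[OF s] by (auto intro!: derivative_eq_intros)
    have d2: "((\<lambda>s. s - \<theta> s) has_real_derivative (1 - \<theta>' s)) (at s)"
      using \<theta>(1)[OF s] by (auto intro!: derivative_eq_intros)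
    have "((\<lambda>s. q (a + \<theta> s) + G (s - \<theta> s)) has_real_derivative ?h s) (at s)"
      using eq[OF s] by (intro DERIV_add DERIV_chain2[OF q(1) d1] DERIV_chain2[OF G(1) d2]) simp
    then have "(f has_real_derivative ?h s) (at s)"
      by (rule has_field_derivative_transform_within_open[OF _ I(1) s]) (simp add: eq)
    with f(1)[OF s] show ?thesis by (rule DERIV_unique)
  qed
  then have "(?h has_real_derivative f'') (at 0)"
    by (intro has_field_derivative_transform_within_open[OF f(2) I])
  moreover have "(?h has_real_derivative q'') (at 0)"
  proof -
    have d1: "((\<lambda>s. a + \<theta> s) has_real_derivative 1) (at 0)"
      using \<theta>(1)[OF I(2)] \<theta>(4) by (auto intro!: derivative_eq_intros)
    have d2: "((\<lambda>s. s - \<theta> s) has_real_derivative 0) (at 0)"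
      using \<theta>(1)[OF I(2)] \<theta>(4) by (auto intro!: derivative_eq_intros)
    have d3: "((\<lambda>s. q' (a + \<theta> s)) has_real_derivative q'' * 1) (at 0)"
      using q(2) \<theta>(3) by (intro DERIV_chain2[OF _ d1]) simp
    have d4: "((\<lambda>s. G' (s - \<theta> s)) has_real_derivative G'' * 0) (at 0)"
      using G(2) \<theta>(3) by (intro DERIV_chain2[OF _ d2]) simp
    have d5: "((\<lambda>s. 1 - \<theta>' s) has_real_derivative 0) (at 0)"
      using \<theta>(2) by (auto intro!: derivative_eq_intros)
    have "(?h has_real_derivative ((q'' * 1) * \<theta>' 0 + 0 * q' (a + \<theta> 0))
        + ((G'' * 0) * (1 - \<theta>' 0) + 0 * G' (0 - \<theta> 0))) (at 0)"
      by (intro DERIV_add DERIV_mult d3 d4 d5 \<theta>(2))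
    then show ?thesis by (simp add: \<theta>(4))
  qed
  ultimately show ?thesis by (rule DERIV_unique)
qed

lemma Ck_on_2_real:
  fixes f :: "real \<Rightarrow> real"
  assumes "open S" "Ck_on 2 S f" "x \<in> S"
  shows "(f has_real_derivative deriv f x) (at x)"
    and "(deriv f has_real_derivative deriv (deriv f) x) (at x)"
proof -
  have 2: "Ck_on (Suc (Suc 0)) S f" using assms(2) by (simp add: numeral_2_eq_2)
  show "(f has_real_derivative deriv f x) (at x)"
    by (rule Ck_on_real_deriv(2)[OF assms(1) 2 assms(3)])
  show "(deriv f has_real_derivative deriv (deriv f) x) (at x)"
    by (rule Ck_on_real_deriv(2)[OF assms(1) Ck_on_real_deriv(1)[OF assms(1) 2] assms(3)])
qed

section \<open>Left-invariant fields acting on functions\<close>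

context lie_group
begin

context
  fixes D :: "'v::euclidean_space \<Rightarrow> ('g \<Rightarrow> real) \<Rightarrow> real"
  assumes D: "lie_algebra_iso A D"
begin

lemma D_linear: "D (a *\<^sub>R v + b *\<^sub>R w) f = a * D v f + b * D w f"
  using D unfolding lie_algebra_iso_def by blast

lemma D_zero: "D 0 f = 0"
  using D_linear[of 0 0 0 0 f] by simp

lemma left_inv_field_lincomb:
  "left_inv_field D (\<Sum>i\<in>I. a i *\<^sub>R v i) f p = (\<Sum>i\<in>I. a i * left_inv_field D (v i) f p)"
proof (induction I rule: infinite_finite_induct)
  case (insert i I)
  have "left_inv_field D (a i *\<^sub>R v i + (\<Sum>i\<in>I. a i *\<^sub>R v i)) f p
      = a i * left_inv_field D (v i) f p + left_inv_field D (\<Sum>i\<in>I. a i *\<^sub>R v i) f p"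
    using D_linear[of "a i" "v i" 1 "\<Sum>i\<in>I. a i *\<^sub>R v i"] by (simp add: left_inv_field_def)
  with insert show ?case by simp
qed (simp_all add: left_inv_field_def D_zero)

lemma derivative_along_subgroup:
  assumes f: "Ck_fun A 1 UNIV f" and \<gamma>: "one_param_subgroup A D v \<gamma>"
  shows "((\<lambda>s. f (p + \<gamma> s)) has_real_derivative left_inv_field D v f (p + \<gamma> s)) (at s)"
proof -
  have add: "\<gamma> (s + t) = \<gamma> s + \<gamma> t" for s t using \<gamma> by (simp add: one_param_subgroup_def)
  have "C1_near A 0 (\<lambda>x. f (p + \<gamma> s + x))"
    by (intro Ck_fun_UNIV_C1_near Ck_fun_translate_UNIV f)
  then have "((\<lambda>h. f (p + \<gamma> s + \<gamma> h)) has_real_derivative D v (\<lambda>x. f (p + \<gamma> s + x))) (at 0)"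
    using \<gamma> unfolding one_param_subgroup_def by blast
  then have "((\<lambda>h. f (p + \<gamma> (h + s))) has_real_derivative left_inv_field D v f (p + \<gamma> s)) (at 0)"
    by (simp add: left_inv_field_def add.commute[of _ s] add add.assoc)
  then show ?thesis using DERIV_shift[of "\<lambda>h. f (p + \<gamma> h)" _ 0 s] by simp
qed

lemma left_inv_field_sum:
  assumes g: "\<And>j. j \<in> I \<Longrightarrow> Ck_fun A 1 UNIV (g j)"
  shows "left_inv_field D v (\<lambda>x. \<Sum>j\<in>I. a j * g j x) p = (\<Sum>j\<in>I. a j * left_inv_field D v (g j) p)"
proof -
  obtain \<gamma> where \<gamma>: "one_param_subgroup A D v \<gamma>" using one_param_subgroup_exists[OF D] .
  have 0: "\<gamma> 0 = 0" using \<gamma> by (intro additive_zero) (simp add: one_param_subgroup_def)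
  have "((\<lambda>s. \<Sum>j\<in>I. a j * g j (p + \<gamma> s)) has_real_derivative
      (\<Sum>j\<in>I. a j * left_inv_field D v (g j) (p + \<gamma> 0))) (at 0)"
    by (intro DERIV_sum DERIV_cmult derivative_along_subgroup[OF g \<gamma>])
  from DERIV_unique[OF derivative_along_subgroup[OF Ck_fun_lincomb \<gamma>] this] g
  show ?thesis by (simp add: 0)
qed

text \<open>In charts, \<open>f (x + y)\<close> is a \<open>C\<^sup>k\<^sup>+\<^sup>1\<close> function of the pair \<open>(x, y)\<close>, and the field differentiates
  it in a fixed direction of \<open>y\<close> at the neutral element.\<close>

lemma left_inv_field_Ck_fun:
  assumes f: "Ck_fun A (Suc k) UNIV f"
  shows "Ck_fun A k UNIV (left_inv_field D v f)"
  unfolding Ck_fun_def comp_def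
proof clarify
  fix W d assume W: "(W, d) \<in> A"
  obtain U c where U: "(U, c) \<in> A" "0 \<in> U" by (rule chart_at)
  obtain w where w: "\<And>f. C1_near A 0 f \<Longrightarrow> D v f = frechet_derivative (\<lambda>y. f (inv_into U c y)) (at (c 0)) w"
    using lie_algebra_element_in_chart[OF D U, of v] by metis
  note opW = chart_image_open[OF W] and opU = chart_image_open[OF U(1)]
  let ?S = "(d ` W) \<times> (c ` U)"
  let ?H = "\<lambda>z. f (inv_into W d (fst z) + inv_into U c (snd z))"
  have S: "open ?S" by (intro open_Times opW opU)
  have H: "Ck_on (Suc k) ?S ?H"
    by (intro Ck_fun_compose[OF f open_UNIV _ S] Ck_into_add[OF S]
        Ck_into_compose[OF opW S _ Ck_into_inv_chart[OF W]] Ck_into_compose[OF opU S _ Ck_into_inv_chart[OF U(1)]]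
        Ck_on_bounded_linear_fun bounded_linear_fst bounded_linear_snd) auto
  have eq: "frechet_derivative ?H (at (x, c 0)) (0, w) = left_inv_field D v f (inv_into W d x)"
    if x: "x \<in> d ` W" for x
  proof -
    have "(x, c 0) \<in> ?S" using x U(2) by blast
    from Ck_on_has_derivative[OF H this]
    have "((\<lambda>y. ?H (x, y)) has_derivative (\<lambda>v. frechet_derivative ?H (at (x, c 0)) (0, v))) (at (c 0))"
      by (rule has_derivative_compose[rotated]) (auto intro!: derivative_eq_intros)
    from frechet_derivative_at[OF this]
    have 1: "frechet_derivative (\<lambda>y. f (inv_into W d x + inv_into U c y)) (at (c 0)) w
        = frechet_derivative ?H (at (x, c 0)) (0, w)" by (simp add: fun_eq_iff)
    have "C1_near A 0 (\<lambda>y. f (inv_into W d x + y))"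
      by (intro Ck_fun_UNIV_C1_near Ck_fun_translate_UNIV Ck_fun_le[OF f]) simp
    from w[OF this] 1 show ?thesis by (simp add: left_inv_field_def)
  qed
  have H': "Ck_on k ?S (\<lambda>z. frechet_derivative ?H (at z) (0, w))" using H by simp
  have "Ck_on k (d ` W) (\<lambda>x. (x, c 0))"
    by (intro Ck_on_Pair Ck_on_const Ck_on_bounded_linear_fun bounded_linear_ident opW)
  from Ck_on_compose[OF opW S _ H' this] U(2)
  have "Ck_on k (d ` W) (\<lambda>x. frechet_derivative ?H (at (x, c 0)) (0, w))" by auto
  then have "Ck_on k (d ` W) (\<lambda>x. left_inv_field D v f (inv_into W d x))"
    by (rule Ck_on_cong[OF opW, rotated]) (rule eq)
  then show "Ck_on k (d ` (W \<inter> UNIV)) (\<lambda>x. left_inv_field D v f (inv_into W d x))" by simp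
qed

lemma horizontal_hessian_quadratic_form:
  fixes a :: "nat \<Rightarrow> real"
  assumes f: "Ck_fun A 2 UNIV f" and \<xi>: "\<xi> = (\<Sum>i=1..m. a i *\<^sub>R X i)"
  shows "(\<Sum>i=1..m. \<Sum>j=1..m. a i * horizontal_hessian D X f p i j * a j)
       = left_inv_field D \<xi> (left_inv_field D \<xi> f) p"
proof -
  let ?L = "left_inv_field D"
  have C1: "Ck_fun A 1 UNIV (?L v f)" for v
    by (rule left_inv_field_Ck_fun) (use f in \<open>simp add: numeral_2_eq_2\<close>)
  have "?L \<xi> f = (\<lambda>x. \<Sum>j=1..m. a j * ?L (X j) f x)"
    unfolding \<xi> by (intro ext left_inv_field_lincomb)
  then have "?L \<xi> (?L \<xi> f) p = (\<Sum>i=1..m. a i * ?L (X i) (\<lambda>x. \<Sum>j=1..m. a j * ?L (X j) f x) p)"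
    unfolding \<xi> by (simp add: left_inv_field_lincomb)
  also have "\<dots> = (\<Sum>i=1..m. \<Sum>j=1..m. a i * a j * ?L (X i) (?L (X j) f) p)"
    by (simp add: left_inv_field_sum[OF C1] sum_distrib_left mult.assoc)
  finally have 1: "?L \<xi> (?L \<xi> f) p = (\<Sum>i=1..m. \<Sum>j=1..m. a i * a j * ?L (X i) (?L (X j) f) p)" .
  have 2: "?L \<xi> (?L \<xi> f) p = (\<Sum>i=1..m. \<Sum>j=1..m. a i * a j * ?L (X j) (?L (X i) f) p)"
    unfolding 1 by (subst sum.swap) (simp add: mult.commute)
  have "(\<Sum>i=1..m. \<Sum>j=1..m. a i * horizontal_hessian D X f p i j * a j)
      = (\<Sum>i=1..m. \<Sum>j=1..m. (a i * a j * ?L (X i) (?L (X j) f) p + a i * a j * ?L (X j) (?L (X i) f) p) / 2)"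
    by (intro sum.cong refl) (simp add: horizontal_hessian_def field_simps)
  also have "\<dots> = (?L \<xi> (?L \<xi> f) p + ?L \<xi> (?L \<xi> f) p) / 2"
    by (subst (1) 1, subst 2) (simp add: sum.distrib sum_divide_distrib add_divide_distrib)
  finally show ?thesis by simp
qed

section \<open>Test functions with a built-in time\<close>

text \<open>If the velocity vanished, then so would the derivative of every function along \<open>\<gamma>\<close> at time 0,
  because translation by \<open>- p\<close> is smooth.  So \<open>\<xi>\<close> would act as the zero vector.\<close>

lemma subgroup_velocity_nonzero:
  assumes \<gamma>: "one_param_subgroup A D \<xi> \<gamma>" and "\<xi> \<noteq> 0"
    and V: "(V, d) \<in> A" "p \<in> V" and e: "((\<lambda>s. d (p + \<gamma> s)) has_vector_derivative e) (at 0)"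
  shows "e \<noteq> 0"
proof
  assume "e = 0"
  have 0: "\<gamma> 0 = 0" using \<gamma> by (intro additive_zero) (simp add: one_param_subgroup_def)
  have cont: "continuous_on UNIV (\<lambda>s. p + \<gamma> s)"
    using \<gamma> by (auto simp: one_param_subgroup_def intro!: continuous_intros)
  have I: "open ((\<lambda>s. p + \<gamma> s) -` V)"
    using continuous_open_preimage[OF cont open_UNIV chart_open[OF V(1)]] by simp
  have "D \<xi> f = 0" for f
  proof (cases "C1_near A 0 f")
    case True
    then obtain W where W: "open W" "0 \<in> W" "Ck_fun A 1 W f" unfolding C1_near_def by blast
    let ?h = "\<lambda>x. f (- p + x)"
    have "open {x. - p + x \<in> W}"
      using open_vimage[OF W(1), of "\<lambda>x. - p + x"] by (simp add: vimage_def continuous_on_add)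
    then have h: "C1_near A p ?h"
      using Ck_fun_translate[OF W(3,1), of "- p"] W(2) unfolding C1_near_def by (intro exI conjI) auto
    let ?F = "frechet_derivative (\<lambda>y. ?h (inv_into V d y)) (at (d p)) 0"
    have "((\<lambda>s. ?h (p + \<gamma> s)) has_real_derivative ?F) (at 0)"
      using e \<open>e = 0\<close> by (intro C1_near_chain_rule[OF h V I]) (auto simp: 0 V(2))
    then have "((\<lambda>s. f (\<gamma> s)) has_real_derivative ?F) (at 0)" by (simp add: add.assoc[symmetric])
    moreover have "((\<lambda>s. f (\<gamma> s)) has_real_derivative D \<xi> f) (at 0)"
      using \<gamma> True unfolding one_param_subgroup_def by blast
    moreover have "((\<lambda>s::real. ?h p) has_real_derivative ?F) (at 0)"
      using V(2) by (intro C1_near_chain_rule[OF h V open_UNIV]) auto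
    then have "?F = 0" by (rule DERIV_unique) simp
    ultimately show ?thesis by (metis DERIV_unique)
  next
    case False
    have "D \<xi> \<in> tangent_space A 0" using D unfolding lie_algebra_iso_def bij_betw_def by blast
    with False show ?thesis unfolding tangent_space_def by auto
  qed
  then have "D \<xi> = D 0" by (simp add: D_zero fun_eq_iff)
  then have "\<xi> = 0" using D unfolding lie_algebra_iso_def bij_betw_def by (meson UNIV_I inj_onD)
  with \<open>\<xi> \<noteq> 0\<close> show False ..
qed

text \<open>The central construction.  Locally \<open>\<phi> x = q (\<tau> x) + \<psi> (x + \<gamma> (- \<tau> x))\<close>, where \<open>\<tau>\<close> plays the role
  of a time coordinate.  The eventual representation of \<open>x\<close> holds for every choice of \<open>\<tau>\<close> and is what
  makes \<open>\<phi>\<close> touch \<open>u\<close> from above later on.  The second derivative requires only that \<open>\<tau>\<close> measures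
  the time along the flow line through \<open>y0 + \<gamma> t0\<close> correctly up to second order, which a quadratic
  polynomial in a chart can achieve.\<close>

lemma test_function_with_time:
  assumes \<gamma>: "one_param_subgroup A D \<xi> \<gamma>" and "\<xi> \<noteq> 0"
    and q: "Ck_on 2 UNIV q" and \<psi>: "Ck_fun A 2 N \<psi>" and N: "open N" "y0 \<in> N"
    and T: "open T" "t0 \<in> T"
  obtains \<phi> where "Ck_fun A 2 UNIV \<phi>" "\<phi> (y0 + \<gamma> t0) = q t0 + \<psi> y0"
    "\<forall>\<^sub>F x in nhds (y0 + \<gamma> t0). \<exists>t\<in>T. \<exists>y\<in>N. x = y + \<gamma> t \<and> \<phi> x = q t + \<psi> y"
    "left_inv_field D \<xi> (left_inv_field D \<xi> \<phi>) (y0 + \<gamma> t0) = deriv (deriv q) t0"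
proof -
  let ?x = "y0 + \<gamma> t0"
  have add: "\<gamma> (s + t) = \<gamma> s + \<gamma> t" for s t using \<gamma> by (simp add: one_param_subgroup_def)
  then have 0: "\<gamma> 0 = 0" by (rule additive_zero)
  have neg: "\<gamma> (- t) + \<gamma> t = 0" "\<gamma> t + \<gamma> (- t) = 0" for t
    using add[of "- t" t] add[of t "- t"] 0 by simp_all
  have \<gamma>2: "Ck_into A 2 UNIV \<gamma>" by (rule one_param_subgroup_Ck_into[OF D \<gamma>])
  have curve: "Ck_into A 2 UNIV (\<lambda>s. p + \<gamma> s)" for p
    by (intro Ck_into_add Ck_into_const \<gamma>2) simp
  obtain V d where V: "(V, d) \<in> A" "?x \<in> V" by (rule chart_at)
  have opV: "open (d ` V)" by (rule chart_image_open[OF V(1)])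
  define z0 where "z0 = d ?x"
  have z0: "z0 \<in> d ` V" "inv_into V d z0 = ?x"
    using V by (auto simp: z0_def chart_inv)
  define I where "I = {s. ?x + \<gamma> s \<in> V}"
  have I: "open I" using Ck_into_preimage_open[OF curve open_UNIV chart_open[OF V(1)]] by (simp add: I_def)
  have I0: "0 \<in> I" using V(2) 0 by (simp add: I_def)
  have dc: "Ck_on 2 I (\<lambda>s. d (?x + \<gamma> s))" using Ck_into_chart[OF curve V(1)] by (simp add: I_def)
  then have "(\<lambda>s. d (?x + \<gamma> s)) differentiable at 0"
    by (rule Ck_on_differentiable) (use I0 in auto)
  then obtain e where e: "((\<lambda>s. d (?x + \<gamma> s)) has_vector_derivative e) (at 0)"
    by (metis vector_derivative_works)
  have "e \<noteq> 0" by (rule subgroup_velocity_nonzero[OF \<gamma> \<open>\<xi> \<noteq> 0\<close> V e])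
  \<comment> \<open>A linear coordinate in the direction of the flow: time to first order.\<close>
  define l where "l z = inverse (e \<bullet> e) * ((z - z0) \<bullet> e)" for z
  have l: "Ck_on k UNIV l" for k
    unfolding l_def by (intro Ck_on_mult Ck_on_const Ck_on_inner Ck_on_diff Ck_on_bounded_linear_fun
        bounded_linear_ident open_UNIV)
  define \<eta> where "\<eta> s = l (d (?x + \<gamma> s))" for s
  have \<eta>: "Ck_on 2 I \<eta>"
    unfolding \<eta>_def by (rule Ck_on_compose[OF I open_UNIV _ l dc]) simp
  have "\<eta> 0 = 0" by (simp add: \<eta>_def l_def 0 z0_def)
  have "((\<lambda>s. inverse (e \<bullet> e) * ((d (?x + \<gamma> s) - z0) \<bullet> e)) has_vector_derivative inverse (e \<bullet> e) * (e \<bullet> e)) (at 0)"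
  proof -
    have bl: "bounded_linear (\<lambda>z. inverse (e \<bullet> e) * (z \<bullet> e))"
      by (intro bounded_linear_compose[OF bounded_linear_mult_right] bounded_linear_inner_left)
    have "((\<lambda>s. d (?x + \<gamma> s) - z0) has_vector_derivative e) (at 0)"
      using has_vector_derivative_diff[OF e has_vector_derivative_const[of z0]] by simp
    from bounded_linear.has_vector_derivative[OF bl this] show ?thesis .
  qed
  then have "(\<eta> has_real_derivative 1) (at 0)"
    using \<open>e \<noteq> 0\<close> by (simp add: \<eta>_def[abs_def] l_def has_real_derivative_iff_has_vector_derivative)
  then have \<eta>1: "deriv \<eta> 0 = 1" by (rule DERIV_imp_deriv)
  \<comment> \<open>The quadratic correction that removes the second-order term of \<open>\<eta>\<close> at 0.\<close>
  define \<kappa> where "\<kappa> = - deriv (deriv \<eta>) 0 / 2"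
  define \<theta> where "\<theta> s = \<eta> s + \<kappa> * (\<eta> s)\<^sup>2" for s
  define \<theta>1 where "\<theta>1 s = deriv \<eta> s + \<kappa> * (2 * \<eta> s * deriv \<eta> s)" for s
  have \<theta>: "(\<theta> has_real_derivative \<theta>1 s) (at s)" if "s \<in> I" for s
    unfolding \<theta>_def \<theta>1_def using Ck_on_2_real(1)[OF I \<eta> that]
    by (auto intro!: derivative_eq_intros)
  have \<theta>1: "(\<theta>1 has_real_derivative 0) (at 0)"
    unfolding \<theta>1_def using Ck_on_2_real[OF I \<eta> I0] \<open>\<eta> 0 = 0\<close> \<eta>1
    by (auto intro!: derivative_eq_intros simp: \<kappa>_def)
  define \<tau> where "\<tau> z = t0 + (l z + \<kappa> * (l z)\<^sup>2)" for z
  have \<tau>: "Ck_on k UNIV \<tau>" for k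
    unfolding \<tau>_def by (intro Ck_on_add Ck_on_const Ck_on_mult Ck_on_power l open_UNIV)
  have \<tau>0: "\<tau> z0 = t0" by (simp add: \<tau>_def l_def)
  have \<tau>\<theta>: "\<tau> (d (?x + \<gamma> s)) = t0 + \<theta> s" for s by (simp add: \<tau>_def \<theta>_def \<eta>_def)
  \<comment> \<open>The point obtained by flowing back for the time \<open>\<tau>\<close>.\<close>
  define Y where "Y z = inv_into V d z + \<gamma> (- \<tau> z)" for z
  have Y: "Ck_into A 2 (d ` V) Y"
    unfolding Y_def
    by (intro Ck_into_add[OF opV] Ck_into_inv_chart[OF V(1)] Ck_into_compose[OF open_UNIV opV _ \<gamma>2]
        Ck_on_minus[OF opV] Ck_on_subset[OF \<tau>]) auto
  have Y0: "Y z0 = y0" by (simp add: Y_def z0 \<tau>0 add.assoc neg)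
  define S where "S = {z\<in>d ` V. Y z \<in> N}"
  have S: "open S" "S \<subseteq> d ` V" "z0 \<in> S"
    using Ck_into_preimage_open[OF Y opV N(1)] z0 Y0 N(2) by (auto simp: S_def)
  define F where "F z = q (\<tau> z) + \<psi> (Y z)" for z
  have F: "Ck_on 2 S F"
    unfolding F_def
    by (intro Ck_on_add[OF S(1)] Ck_on_compose[OF S(1) open_UNIV _ q Ck_on_subset[OF \<tau>]]
        Ck_fun_compose[OF \<psi> N(1) Ck_into_subset[OF Y S(2)] S(1)]) (auto simp: S_def)
  obtain \<phi> where \<phi>: "Ck_fun A 2 UNIV \<phi>" and ev: "\<forall>\<^sub>F x in nhds ?x. \<phi> x = F (d x)"
    using Ck_fun_local_extension[OF V(1) S F] z0(2) by auto
  have loc: "\<forall>\<^sub>F x in nhds ?x. x \<in> V \<and> d x \<in> S'" if "open S'" "z0 \<in> S'" for S'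
  proof -
    have "open (V \<inter> d -` S')"
      by (rule continuous_open_preimage[OF chart_continuous[OF V(1)] chart_open[OF V(1)] that(1)])
    then show ?thesis using V(2) that(2) unfolding eventually_nhds
      by (intro exI[of _ "V \<inter> d -` S'"]) (auto simp: z0_def)
  qed
  show thesis
  proof (rule that[OF \<phi>])
    show "\<phi> ?x = q t0 + \<psi> y0"
      using eventually_nhds_x_imp_x[OF ev] by (simp add: F_def z0_def[symmetric] \<tau>0 Y0)
  next
    have "open (S \<inter> \<tau> -` T)"
      by (rule continuous_open_preimage[OF continuous_on_subset[OF Ck_on_continuous[OF \<tau>]] S(1) T(1)]) simp
    then have "\<forall>\<^sub>F x in nhds ?x. x \<in> V \<and> d x \<in> S \<inter> \<tau> -` T"
      using S(3) T(2) \<tau>0 by (intro loc) auto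
    with ev show "\<forall>\<^sub>F x in nhds ?x. \<exists>t\<in>T. \<exists>y\<in>N. x = y + \<gamma> t \<and> \<phi> x = q t + \<psi> y"
    proof eventually_elim
      case (elim x)
      then have "x = Y (d x) + \<gamma> (\<tau> (d x))"
        by (simp add: Y_def chart_inv[OF V(1)] add.assoc neg)
      with elim show ?case by (intro bexI[of _ "\<tau> (d x)"] bexI[of _ "Y (d x)"]) (auto simp: F_def S_def)
    qed
  next
    define J where "J = {r. y0 + \<gamma> r \<in> N}"
    define G where "G r = \<psi> (y0 + \<gamma> r)" for r
    have J: "open J" using Ck_into_preimage_open[OF curve open_UNIV N(1)] by (simp add: J_def)
    have J0: "0 \<in> J" using N(2) 0 by (simp add: J_def)
    have G: "Ck_on 2 J G"
      unfolding G_def by (rule Ck_fun_compose[OF \<psi> N(1) Ck_into_subset[OF curve] J]) (auto simp: J_def)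
    obtain O' where O': "open O'" "?x \<in> O'" "\<And>x. x \<in> O' \<Longrightarrow> \<phi> x = F (d x) \<and> x \<in> V \<and> d x \<in> S"
      using eventually_conj[OF ev loc[OF S(1,3)]] unfolding eventually_nhds by blast
    define I' where "I' = {s. ?x + \<gamma> s \<in> O'}"
    have I': "open I'" using Ck_into_preimage_open[OF curve open_UNIV O'(1)] by (simp add: I'_def)
    have sub: "I' \<subseteq> I" using O'(3) by (auto simp: I'_def I_def)
    show "left_inv_field D \<xi> (left_inv_field D \<xi> \<phi>) ?x = deriv (deriv q) t0"
    proof (rule second_derivative_after_reparametrisation[where f="\<lambda>s. \<phi> (?x + \<gamma> s)"
          and f'="\<lambda>s. left_inv_field D \<xi> \<phi> (?x + \<gamma> s)" and q=q and G=G and \<theta>=\<theta>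
          and \<theta>'=\<theta>1 and q'="deriv q" and G'="deriv G" and I=I' and J=J and a=t0])
      show "open I'" by (rule I')
      show "0 \<in> I'" using O'(2) by (simp add: I'_def 0)
      show "(\<theta> has_real_derivative \<theta>1 s) (at s)" if "s \<in> I'" for s using \<theta> sub that by blast
      show "(\<theta>1 has_real_derivative 0) (at 0)" by (rule \<theta>1)
      show "\<theta> 0 = 0" "\<theta>1 0 = 1" by (simp_all add: \<theta>_def \<theta>1_def \<open>\<eta> 0 = 0\<close> \<eta>1)
      show "(q has_real_derivative deriv q t) (at t)" for t by (rule Ck_on_2_real(1)[OF open_UNIV q UNIV_I])
      show "(deriv q has_real_derivative deriv (deriv q) t0) (at t0)"
        by (rule Ck_on_2_real(2)[OF open_UNIV q UNIV_I])
      show "(G has_real_derivative deriv G r) (at r)" if "r \<in> J" for r by (rule Ck_on_2_real(1)[OF J G that])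
      show "(deriv G has_real_derivative deriv (deriv G) 0) (at 0)" by (rule Ck_on_2_real(2)[OF J G J0])
      show "((\<lambda>s. \<phi> (?x + \<gamma> s)) has_real_derivative left_inv_field D \<xi> \<phi> (?x + \<gamma> s)) (at s)" for s
        by (rule derivative_along_subgroup[OF Ck_fun_le[OF \<phi>] \<gamma>]) simp
      have "Ck_fun A 1 UNIV (left_inv_field D \<xi> \<phi>)"
        by (rule left_inv_field_Ck_fun) (use \<phi> in \<open>simp add: numeral_2_eq_2\<close>)
      from derivative_along_subgroup[OF this \<gamma>, of ?x 0]
      show "((\<lambda>s. left_inv_field D \<xi> \<phi> (?x + \<gamma> s)) has_real_derivative
          left_inv_field D \<xi> (left_inv_field D \<xi> \<phi>) ?x) (at 0)" by (simp add: 0)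
      fix s assume s: "s \<in> I'"
      let ?z = "d (?x + \<gamma> s)"
      have z: "\<phi> (?x + \<gamma> s) = F ?z" "?x + \<gamma> s \<in> V" "?z \<in> S" using O'(3) s by (auto simp: I'_def)
      have "Y ?z = y0 + (\<gamma> t0 + \<gamma> s + \<gamma> (- (t0 + \<theta> s)))"
        unfolding Y_def chart_inv[OF V(1) z(2)] \<tau>\<theta> by (simp only: add.assoc)
      also have "\<dots> = y0 + \<gamma> (s - \<theta> s)" by (simp flip: add)
      finally have Yz: "Y ?z = y0 + \<gamma> (s - \<theta> s)" .
      with z(3) have "s - \<theta> s \<in> J" by (simp add: J_def S_def)
      with z(1) Yz show "s - \<theta> s \<in> J \<and> \<phi> (?x + \<gamma> s) = q (t0 + \<theta> s) + G (s - \<theta> s)"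
        by (simp add: F_def \<tau>\<theta> G_def)
    qed
  qed
qed

section \<open>Convexity along one-parameter subgroups\<close>

text \<open>A touching argument with the redundant variables \<open>(t, y)\<close>.  At an interior maximum, all
  representations \<open>x = y + \<gamma> t\<close> of nearby points compete, and the test function with built-in time
  picks one of them for each \<open>x\<close> so that only \<open>q\<close> contributes to the second derivative.\<close>

lemma usc_subsolution_convex_along_subgroup:
  assumes \<gamma>: "one_param_subgroup A D \<xi> \<gamma>" and "\<xi> \<noteq> 0" and u: "usc_on UNIV u"
    and sub: "\<And>\<phi> x. Ck_fun A 2 UNIV \<phi> \<Longrightarrow> touches_above_at \<phi> u x \<Longrightarrow>
      0 \<le> left_inv_field D \<xi> (left_inv_field D \<xi> \<phi>) x"
  shows "convex_on UNIV (\<lambda>t. u (p + \<gamma> t))"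
proof (rule convex_on_linorderI)
  fix s a b :: real assume s: "0 < s" "s < 1" and ab: "a < b"
  let ?g = "\<lambda>t. u (p + \<gamma> t)"
  define t0 where "t0 = (1 - s) * a + s * b"
  have t0: "a < t0" "t0 < b"
  proof -
    have "0 < s * (b - a)" "0 < (1 - s) * (b - a)" using s ab by simp_all
    then show "a < t0" "t0 < b" by (simp_all add: t0_def algebra_simps)
  qed
  show "?g ((1 - s) *\<^sub>R a + s *\<^sub>R b) \<le> (1 - s) * ?g a + s * ?g b"
  proof (rule ccontr)
    assume "\<not> ?thesis"
    then have gt: "?g t0 > (1 - s) * ?g a + s * ?g b" by (simp add: t0_def)
    define k where "k = (?g b - ?g a) / (b - a)"
    define L where "L t = ?g a + k * (t - a)" for t
    have kb: "k * (b - a) = ?g b - ?g a" using ab by (simp add: k_def)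
    have La: "L a = ?g a" and Lb: "L b = ?g b" using kb by (simp_all add: L_def)
    have "L t0 = ?g a + s * (k * (b - a))" by (simp add: L_def t0_def algebra_simps)
    then have Lt0: "L t0 < ?g t0" using gt unfolding kb by (simp add: algebra_simps)
    define w0 where "w0 = 1 + (t0 - a) * (b - t0)"
    have w0: "w0 > 0" using t0 by (simp add: w0_def add_pos_pos)
    define \<delta> where "\<delta> = (?g t0 - L t0) / (2 * w0)"
    have \<delta>: "\<delta> > 0" using Lt0 w0 by (simp add: \<delta>_def)
    \<comment> \<open>A strictly concave perturbation of the chord \<open>L\<close>, lifted by \<open>\<delta>\<close>.  The size of \<open>\<delta>\<close> is such
      that \<open>q t0\<close> is the mean of \<open>L t0\<close> and the value of the function at \<open>t0\<close>.\<close>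
    define q where "q t = L t + \<delta> * (1 + (t - a) * (b - t))" for t
    have qa: "?g a < q a" and qb: "?g b < q b" using La Lb \<delta> by (simp_all add: q_def)
    have "q t0 = L t0 + (?g t0 - L t0) / 2" using w0 by (simp add: q_def \<delta>_def w0_def[symmetric])
    with Lt0 have qt0: "q t0 < ?g t0" by (simp add: field_simps)
    have qC: "Ck_on 2 UNIV q"
      unfolding q_def L_def
      by (intro Ck_on_add Ck_on_mult Ck_on_diff Ck_on_const Ck_on_bounded_linear_fun bounded_linear_ident open_UNIV)
    have "(q has_real_derivative (k + \<delta> * ((b - t) - (t - a)))) (at t)" for t
      unfolding q_def L_def by (auto intro!: derivative_eq_intros)
    then have "deriv q = (\<lambda>t. k + \<delta> * ((b - t) - (t - a)))" by (intro ext DERIV_imp_deriv)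
    moreover have "((\<lambda>t. k + \<delta> * ((b - t) - (t - a))) has_real_derivative - 2 * \<delta>) (at t)" for t
      by (auto intro!: derivative_eq_intros)
    ultimately have q2: "deriv (deriv q) t = - 2 * \<delta>" for t by (simp add: DERIV_imp_deriv)

    obtain U c where U: "(U, c) \<in> A" "p \<in> U" by (rule chart_at)
    have opU: "open (c ` U)" by (rule chart_image_open[OF U(1)])
    define z0 where "z0 = c p"
    have z0: "z0 \<in> c ` U" "inv_into U c z0 = p" using U by (auto simp: z0_def chart_inv)
    have \<gamma>c: "continuous_on UNIV \<gamma>" using \<gamma> by (simp add: one_param_subgroup_def)
    define \<Phi> where "\<Phi> z = inv_into U c (snd z) + \<gamma> (fst z)" for z
    have \<Phi>: "continuous_on (UNIV \<times> c ` U) \<Phi>"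
      unfolding \<Phi>_def by (intro continuous_on_add continuous_on_compose2[OF chart_inv_continuous[OF U(1)]]
          continuous_on_compose2[OF \<gamma>c] continuous_on_fst continuous_on_snd continuous_on_id) auto
    have face: "\<exists>\<rho>>0. \<forall>z\<in>cball z0 \<rho>. z \<in> c ` U \<and> u (\<Phi> (t, z)) < K" if K: "?g t < K" for t K
    proof -
      have "\<forall>\<^sub>F x in nhds (p + \<gamma> t). u x < K"
        using u K unfolding usc_on_def by (simp add: eventually_nhds_conv_at)
      then obtain O' where O': "open O'" "p + \<gamma> t \<in> O'" "\<And>x. x \<in> O' \<Longrightarrow> u x < K"
        unfolding eventually_nhds by blast
      have "continuous_on (c ` U) (\<lambda>z. \<Phi> (t, z))"
        by (intro continuous_on_compose2[OF \<Phi>] continuous_intros) auto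
      from continuous_open_preimage[OF this opU O'(1)]
      have "open (c ` U \<inter> (\<lambda>z. \<Phi> (t, z)) -` O')" .
      moreover have "z0 \<in> c ` U \<inter> (\<lambda>z. \<Phi> (t, z)) -` O'" using z0 O'(2) by (simp add: \<Phi>_def)
      ultimately obtain \<rho> where "\<rho> > 0" "cball z0 \<rho> \<subseteq> c ` U \<inter> (\<lambda>z. \<Phi> (t, z)) -` O'"
        by (meson open_contains_cball)
      then show ?thesis using O'(3) by blast
    qed
    obtain \<rho>a where \<rho>a: "\<rho>a > 0" "\<And>z. z \<in> cball z0 \<rho>a \<Longrightarrow> z \<in> c ` U \<and> u (\<Phi> (a, z)) < q a"
      using face[OF qa] by blast
    obtain \<rho>b where \<rho>b: "\<rho>b > 0" "\<And>z. z \<in> cball z0 \<rho>b \<Longrightarrow> z \<in> c ` U \<and> u (\<Phi> (b, z)) < q b"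
      using face[OF qb] by blast
    define \<rho> where "\<rho> = min \<rho>a \<rho>b"
    have \<rho>: "\<rho> > 0" "cball z0 \<rho> \<subseteq> cball z0 \<rho>a" "cball z0 \<rho> \<subseteq> cball z0 \<rho>b" using \<rho>a \<rho>b by (auto simp: \<rho>_def)
    define K where "K = {a..b} \<times> cball z0 \<rho>"
    have K: "compact K" "K \<noteq> {}" "(t0, z0) \<in> K"
      using t0 \<rho>(1) by (auto simp: K_def intro: compact_Times)
    have \<Phi>K: "continuous_on K \<Phi>"
      by (rule continuous_on_subset[OF \<Phi>]) (use \<rho>(2) \<rho>a(2) in \<open>auto simp: K_def\<close>)
    have qc: "continuous_on T (\<lambda>z. q (fst z))" for T :: "(real \<times> 'e) set"
      by (rule continuous_on_compose2[OF Ck_on_continuous[OF qC]]) (auto intro!: continuous_intros)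
    obtain B where B: "\<And>z. z \<in> K \<Longrightarrow> u (\<Phi> z) - q (fst z) \<le> B"
      using usc_on_attains_max[OF usc_on_compose_diff[OF u \<Phi>K qc] K(1,2)] by metis
    \<comment> \<open>Large enough for the penalty to outweigh the bound \<open>B\<close> at distance \<open>\<rho>\<close> from \<open>z0\<close>.\<close>
    define C where "C = (\<bar>B\<bar> + 1) / \<rho>\<^sup>2"
    have C: "C \<ge> 0" "C * \<rho>\<^sup>2 > B" using \<rho>(1) by (auto simp: C_def)
    define w where "w z = u (\<Phi> z) - (q (fst z) + C * ((snd z - z0) \<bullet> (snd z - z0)))" for z
    have "continuous_on K (\<lambda>z. q (fst z) + C * ((snd z - z0) \<bullet> (snd z - z0)))"
      by (intro continuous_on_add qc) (intro continuous_intros)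
    from usc_on_attains_max[OF usc_on_compose_diff[OF u \<Phi>K this] K(1,2)]
    obtain zz where zz: "zz \<in> K" "\<And>z. z \<in> K \<Longrightarrow> w z \<le> w zz" unfolding w_def by metis
    obtain t1 z1 where tz: "zz = (t1, z1)" by (cases zz)
    define M where "M = w zz"
    have "M > 0"
    proof -
      have "w (t0, z0) = ?g t0 - q t0" by (simp add: w_def \<Phi>_def z0)
      then show ?thesis using zz(2)[OF K(3)] qt0 by (simp add: M_def)
    qed
    have sq: "0 \<le> C * ((z1 - z0) \<bullet> (z1 - z0))" using C(1) by simp
    have z1: "z1 \<in> cball z0 \<rho>" and t1: "t1 \<in> {a..b}" using zz(1) by (auto simp: K_def tz)
    \<comment> \<open>A positive maximum cannot lie on the two end faces, nor on the lateral boundary.\<close>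
    have "t1 \<noteq> a"
      using \<rho>a(2)[of z1] z1 \<rho>(2) \<open>M > 0\<close> sq by (auto simp: M_def w_def tz)
    moreover have "t1 \<noteq> b"
      using \<rho>b(2)[of z1] z1 \<rho>(3) \<open>M > 0\<close> sq by (auto simp: M_def w_def tz)
    ultimately have t1: "t1 \<in> {a<..<b}" using t1 by auto
    have "dist z0 z1 \<noteq> \<rho>"
    proof
      assume "dist z0 z1 = \<rho>"
      then have "(z1 - z0) \<bullet> (z1 - z0) = \<rho>\<^sup>2"
        by (metis dist_commute dist_norm power2_norm_eq_inner)
      then show False using B[OF zz(1)] C(2) \<open>M > 0\<close> by (simp add: M_def w_def tz)
    qed
    then have z1b: "z1 \<in> ball z0 \<rho>" using z1 by simp
    define y1 where "y1 = inv_into U c z1"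
    have "z1 \<in> c ` U" using \<rho>(2) \<rho>a(2) z1 by blast
    then have y1: "y1 \<in> U" "c y1 = z1" by (simp_all add: y1_def inv_into_into chart_right_inv)
    define N where "N = U \<inter> c -` ball z0 \<rho>"
    have N: "open N" unfolding N_def
      by (rule continuous_open_preimage[OF chart_continuous[OF U(1)] chart_open[OF U(1)] open_ball])
    have y1N: "y1 \<in> N" using y1 z1b by (simp add: N_def)
    define \<psi> where "\<psi> y = C * ((c y - z0) \<bullet> (c y - z0)) + M" for y
    have \<psi>: "Ck_fun A 2 N \<psi>"
    proof (rule Ck_funI)
      fix y assume "y \<in> N"
      have opN: "open (c ` N)" using chart_image_open_subset[OF U(1) N] by (simp add: N_def Int_absorb1)
      have "Ck_on 2 (c ` N) (\<lambda>z. C * ((z - z0) \<bullet> (z - z0)) + M)"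
        by (intro Ck_on_add Ck_on_mult Ck_on_inner Ck_on_diff Ck_on_const Ck_on_bounded_linear_fun
            bounded_linear_ident opN)
      then have "Ck_on 2 (c ` N) (\<lambda>z. \<psi> (inv_into U c z))"
        by (rule Ck_on_cong[OF opN, rotated]) (auto simp: \<psi>_def N_def chart_inv[OF U(1)])
      then show "\<exists>(U, c)\<in>A. \<exists>N. open N \<and> y \<in> N \<and> N \<subseteq> U \<and> Ck_on 2 (c ` N) (\<lambda>z. \<psi> (inv_into U c z))"
        using \<open>y \<in> N\<close> N by (intro bexI[OF _ U(1)]) (auto intro!: exI[of _ N] simp: N_def)
    qed
    obtain \<phi> where \<phi>: "Ck_fun A 2 UNIV \<phi>" "\<phi> (y1 + \<gamma> t1) = q t1 + \<psi> y1"
      and ev: "\<forall>\<^sub>F x in nhds (y1 + \<gamma> t1). \<exists>t\<in>{a<..<b}. \<exists>y\<in>N. x = y + \<gamma> t \<and> \<phi> x = q t + \<psi> y"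
      and XX: "left_inv_field D \<xi> (left_inv_field D \<xi> \<phi>) (y1 + \<gamma> t1) = deriv (deriv q) t1"
      by (rule test_function_with_time[OF \<gamma> \<open>\<xi> \<noteq> 0\<close> qC \<psi> N y1N open_greaterThanLessThan t1])
    have val: "w (t, c y) = u (y + \<gamma> t) - (q t + \<psi> y) + M" if "y \<in> N" for t y
      using that by (simp add: w_def \<Phi>_def \<psi>_def N_def chart_inv[OF U(1)])
    have "u (y1 + \<gamma> t1) = \<phi> (y1 + \<gamma> t1)"
      using val[OF y1N, of t1] \<phi>(2) by (simp add: y1(2) M_def tz)
    moreover have "\<forall>\<^sub>F x in nhds (y1 + \<gamma> t1). u x \<le> \<phi> x"
    proof (rule eventually_mono[OF ev])
      fix x assume "\<exists>t\<in>{a<..<b}. \<exists>y\<in>N. x = y + \<gamma> t \<and> \<phi> x = q t + \<psi> y"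
      then obtain t y where ty: "t \<in> {a<..<b}" "y \<in> N" "x = y + \<gamma> t" "\<phi> x = q t + \<psi> y" by blast
      then have "(t, c y) \<in> K" by (auto simp: K_def N_def)
      from zz(2)[OF this] val[OF ty(2), of t] ty show "u x \<le> \<phi> x" by (simp add: M_def)
    qed
    ultimately have "touches_above_at \<phi> u (y1 + \<gamma> t1)" by (simp add: touches_above_at_def)
    from sub[OF \<phi>(1) this] show False using XX q2 \<delta> by simp
  qed
qed simp

end

end

section \<open>v-convexity implies h-convexity\<close>

theorem theoremA:
  fixes A :: "('g::{topological_group_add, t2_space, second_countable_topology},
               'e::euclidean_space) chart set"
    and D :: "'v::euclidean_space \<Rightarrow> ('g \<Rightarrow> real) \<Rightarrow> real"
    and r m :: nat
    and V :: "nat \<Rightarrow> 'v set"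
    and X :: "nat \<Rightarrow> 'v"
    and u :: "'g \<Rightarrow> real"
  assumes "carnot_group A D r V m X"
    and "usc_on UNIV u"
    and "locally_bounded_below_on UNIV u"
    and "v_convex_on A D m X UNIV u"
  shows "h_convex_on A D (V 1) UNIV u"
proof -
  interpret carnot_group A D r V m X by (rule assms(1))
  have "convex_on {0..1} (\<lambda>t. u (p + lie_exp A D (t *\<^sub>R \<xi>)))" if \<xi>: "\<xi> \<in> V 1" for p \<xi>
  proof (cases "\<xi> = 0")
    case True
    then show ?thesis by (simp add: convex_on_def algebra_simps flip: distrib_right)
  next
    case False
    have "\<xi> \<in> span (X ` {1..m})" using \<xi> basis_span by simp
    then obtain a where a: "\<xi> = (\<Sum>i=1..m. a i *\<^sub>R X i)"
    proof (induction rule: span_induct_alt)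
      case base
      show ?case by (rule base[of "\<lambda>_. 0"]) simp
    next
      case (step c x y)
      then obtain i where i: "i \<in> {1..m}" "x = X i" by blast
      show ?case
      proof (rule step(2))
        fix b assume "y = (\<Sum>i=1..m. b i *\<^sub>R X i)"
        then show thesis
          using i by (intro step(3)[of "\<lambda>j. (if j = i then c else 0) + b j"])
            (simp add: scaleR_add_left sum.distrib if_distrib[of "\<lambda>a. a *\<^sub>R _"] sum.delta cong: if_cong)
      qed
    qed
    obtain \<gamma> where \<gamma>: "one_param_subgroup A D \<xi> \<gamma>" using one_param_subgroup_exists[OF lie_algebra] .
    have "convex_on UNIV (\<lambda>t. u (p + \<gamma> t))"
    proof (rule usc_subsolution_convex_along_subgroup[OF lie_algebra \<gamma> False assms(2)])
      fix \<phi> x assume \<phi>: "Ck_fun A 2 UNIV \<phi>" "touches_above_at \<phi> u x"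
      then have "0 \<le> (\<Sum>i=1..m. \<Sum>j=1..m. a i * horizontal_hessian D X \<phi> x i j * a j)"
        using assms(4) unfolding v_convex_on_def by blast
      then show "0 \<le> left_inv_field D \<xi> (left_inv_field D \<xi> \<phi>) x"
        using horizontal_hessian_quadratic_form[OF lie_algebra \<phi>(1) a] by simp
    qed
    then show ?thesis
      unfolding lie_exp_scaleR[OF lie_algebra \<gamma>] by (rule convex_on_subset) simp_all
  qed
  then show ?thesis unfolding h_convex_on_def by blast
qed

end
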